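(* Let $(\mathcal{A},\alpha)$ be a unital Krein $C^*$-algebra, $\mathcal{X}$ a full Hilbert $\mathcal{A}$-module, $\mathcal{G}$ a locally compact group and $\eta$ an action of $\mathcal{G}$ on $\mathcal{X}$. Let $(\mathcal{H}_1,J_1)$ and $(\mathcal{H}_2,J_2=\mathrm{id}_{\mathcal{H}_2})$ be Krein spaces, let $u$ be a simultaneously unitary and pseudo-unitary representation of $\mathcal{G}$ on $(\mathcal{H}_1,J_1)$ and $u'$ a pseudo-unitary representation of $\mathcal{G}$ on $(\mathcal{H}_2,J_2)$. Let $\varphi:\mathcal{A}\to\mathcal{L}(\mathcal{H}_1)$ be an $\alpha$-completely positive map and $\Phi:\mathcal{X}\to\mathcal{L}(\mathcal{H}_1,\mathcal{H}_2)$ a $\varphi$-map which is $(u',u)$-covariant with respect to $\eta$. If $(\pi_{\mathcal{X}},\pi_\varphi,V_\Phi,W_\Phi,v,v',(\mathcal{K}_1,J_3),(\mathcal{K}_2,J_4))$ and $(\pi'_{\mathcal{X}},\pi'_\varphi,V'_\Phi,W'_\Phi,w,w',(\mathcal{K}'_1,J'_3),(\mathcal{K}'_2,J'_4))$ are two minimal covariant KSGNS constructions for $\Phi$, then there exist two unitary operators $U_1:\mathcal{K}_1\to\mathcal{K}'_1$ and $U_2:\mathcal{K}_2\to\mathcal{K}'_2$ such that: (1) $U_1V_\Phi=V'_\Phi$, $U_1\pi_\varphi(a)U_1^{\#}=\pi'_\varphi(a)$ for all $a\in\mathcal{A}$, and $U_1v_tU_1^{\#}=w_t$ for all $t\in\mathcal{G}$;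 (2) $U_2W_\Phi=W'_\Phi$, $U_2\pi_{\mathcal{X}}(x)U_1^{\#}=\pi'_{\mathcal{X}}(x)$ for all $x\in\mathcal{X}$, and $U_2v'_tU_2^{\#}=w'_t$ for all $t\in\mathcal{G}$.
   Context: Maps and operators are bounded and linear; inner products are linear in the second variable; $\mathcal{L}(\cdot,\cdot)$ denotes bounded operators between Hilbert spaces. A coisometry is $W$ with $WW^*=\mathrm{id}$; unitary means $U^*U=\mathrm{id}$, $UU^*=\mathrm{id}$ for the Hilbert space adjoint. $[S]$ denotes the closed linear span of $S$. Krein $C^*$-algebra: a pair $(\mathcal{A},\alpha)$ with $\mathcal{A}$ a $C^*$-algebra and $\alpha$ a $*$-automorphism of $\mathcal{A}$ with $\alpha^2=\mathrm{id}$; put $a^{\#}=\alpha(a^* )$. Krein space: a pair $(\mathcal{H},J)$ with $\mathcal{H}$ a complex Hilbert space and $J\in\mathcal{L}(\mathcal{H})$, $J=J^*=J^{-1}$. For Krein spaces $(\mathcal{H},J)$, $(\mathcal{H}',J')$ and $T\in\mathcal{L}(\mathcal{H},\mathcal{H}')$ put $T^{\#}=JT^*J'\in\mathcal{L}(\mathcal{H}',\mathcal{H})$. $\alpha$-completely positive ($\alpha$-CP) map of $\mathcal{A}$ on $(\mathcal{H},J)$: a map $\varphi:\mathcal{A}\to\mathcal{L}(\mathcal{H})$ with $\varphi(a^* )=\varphi(a)^*$ such that (i) $\varphi(\alpha(a))=J\varphi(a)J=\varphi(a)$ for all $a$; (ii) the matrix $[\varphi(a_i^{\#}a_j)]_{i,j=1}^n$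 is positive for all $n\ge1$ and $a_1,\dots,a_n\in\mathcal{A}$; (iii) for every $a\in\mathcal{A}$ there is $M(a)>0$ with $[\varphi((aa_i)^{\#}aa_j)]_{i,j=1}^n\le M(a)[\varphi(a_i^{\#}a_j)]_{i,j=1}^n$ for all $n\ge1$ and $a_1,\dots,a_n\in\mathcal{A}$. $\varphi$-map: a map $\Phi:\mathcal{X}\to\mathcal{L}(\mathcal{H}_1,\mathcal{H}_2)$ with $\Phi(x)^{\#}\Phi(y)=\varphi(\langle x,y\rangle)$ for all $x,y\in\mathcal{X}$. Representation of $\mathcal{A}$ on $(\mathcal{K},J)$: a homomorphism $\pi:\mathcal{A}\to\mathcal{L}(\mathcal{K})$ with $\pi(a^* )=J\pi(a)^*J=\pi(a)^{\#}$. $\pi_{\mathcal{A}}$-representation of $\mathcal{X}$ on $(\mathcal{K}_1,J_3)$, $(\mathcal{K}_2,J_4)$, where $\pi_{\mathcal{A}}$ is a representation of $\mathcal{A}$ on $(\mathcal{K}_1,J_3)$: a map $\pi_{\mathcal{X}}:\mathcal{X}\to\mathcal{L}(\mathcal{K}_1,\mathcal{K}_2)$ with $\pi_{\mathcal{X}}(x)^{\#}\pi_{\mathcal{X}}(y)=\pi_{\mathcal{A}}(\langle x,y\rangle)$ for all $x,y$. Action of $\mathcal{G}$ on the full Hilbert $\mathcal{A}$-module $\mathcal{X}$: a group morphism $t\mapsto\eta_t$ from $\mathcal{G}$ to the group of Hilbert $C^*$-module isomorphisms of $\mathcal{X}$ onto itself (bijective linear maps $\theta$ for which there is a $*$-automorphism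 $\beta$ of $\mathcal{A}$ with $\langle\theta x,\theta y\rangle=\beta(\langle x,y\rangle)$), such that $t\mapsto\eta_t(x)$ is continuous for each $x\in\mathcal{X}$. It induces a unique action $t\mapsto\beta_t^\eta$ of $\mathcal{G}$ on $\mathcal{A}$ with $\beta_t^\eta(\langle x,y\rangle)=\langle\eta_t(x),\eta_t(y)\rangle$. Pseudo-unitary representation of $\mathcal{G}$ on $(\mathcal{H},J)$: a map $t\mapsto u_t\in\mathcal{L}(\mathcal{H})$ with $u_e=\mathrm{id}$, $u_{ts}=u_tu_s$, $u_{t^{-1}}=u_t^{\#}$. It is simultaneously unitary and pseudo-unitary if moreover every $u_t$ is unitary, so that $u_t^*=u_t^{\#}$, equivalently $J u_t=u_tJ$. A $\varphi$-map $\Phi$ is $(u',u)$-covariant with respect to $\eta$ if $\Phi(\eta_t(x))=u'_t\Phi(x)u_t^{\#}$ for all $t\in\mathcal{G}$, $x\in\mathcal{X}$, and $\beta_t^\eta\circ\alpha=\alpha\circ\beta_t^\eta$ for all $t\in\mathcal{G}$. A representation $\pi_{\mathcal{X}}$ of $\mathcal{X}$ is $(v',v)$-covariant with respect to $\eta$ if $\pi_{\mathcal{X}}(\eta_t(x))=v'_t\pi_{\mathcal{X}}(x)v_t^{\#}$ for all $t\in\mathcal{G}$, $x\in\mathcal{X}$. Covariant KSGNS construction associated to such a $\Phi$: a tuple $(\pi_{\mathcal{X}},\pi_\varphi,V_\Phi,W_\Phi,v,v',(\mathcal{K}_1,J_3),(\mathcal{K}_2,J_4))$ consisting of Krein spaces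 $(\mathcal{K}_1,J_3)$, $(\mathcal{K}_2,J_4)$, pseudo-unitary representations $v$, $v'$ of $\mathcal{G}$ on them, a representation $\pi_\varphi$ of $\mathcal{A}$ on $(\mathcal{K}_1,J_3)$, a $\pi_\varphi$-representation $\pi_{\mathcal{X}}$ of $\mathcal{X}$ on $(\mathcal{K}_1,J_3)$ and $(\mathcal{K}_2,J_4)$ that is $(v',v)$-covariant with respect to $\eta$, and operators $V_\Phi:\mathcal{H}_1\to\mathcal{K}_1$, $W_\Phi:\mathcal{H}_2\to\mathcal{K}_2$ such that: $V_\Phi^{\#}=V_\Phi^*$; $\pi_\varphi(\alpha(a))V_\Phi=J_3\pi_\varphi(a)V_\Phi J_1$ for all $a\in\mathcal{A}$; $W_\Phi$ is a coisometry with $W_\Phi^{\#}=W_\Phi^*$; $\varphi(a)=V_\Phi^{\#}\pi_\varphi(a)V_\Phi$ for all $a\in\mathcal{A}$; $\Phi(x)=W_\Phi^{\#}\pi_{\mathcal{X}}(x)V_\Phi$ for all $x\in\mathcal{X}$; $v_t^{\#}=v_t^*$ and $(v'_t)^{\#}=(v'_t)^*$ for all $t$; $V_\Phi u_t=v_tV_\Phi$ and $W_\Phi u'_t=v'_tW_\Phi$ for all $t\in\mathcal{G}$. It is minimal if $\mathcal{K}_2=[\pi_{\mathcal{X}}(\mathcal{X})V_\Phi\mathcal{H}_1]$ and $\mathcal{K}_1=[\pi_\varphi(\mathcal{A})V_\Phi\mathcal{H}_1]$. *)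

theory Defs
  imports "HOL-Analysis.Analysis"
begin

section \<open>Complex Hilbert spaces and bounded operators\<close>

class complex_vector = real_vector +
  fixes scaleC :: "complex \<Rightarrow> 'a \<Rightarrow> 'a" (infixr \<open>*\<^sub>C\<close> 75)
  assumes scaleC_add_right: "c *\<^sub>C (x + y) = c *\<^sub>C x + c *\<^sub>C y"
    and scaleC_add_left: "(c + d) *\<^sub>C x = c *\<^sub>C x + d *\<^sub>C x"
    and scaleC_scaleC: "c *\<^sub>C d *\<^sub>C x = (c * d) *\<^sub>C x"
    and scaleC_of_real: "complex_of_real r *\<^sub>C x = r *\<^sub>R x"

class complex_normed_vector = complex_vector + real_normed_vector +
  assumes norm_scaleC: "norm (c *\<^sub>C x) = cmod c * norm x"

text \<open>Inner products are linear in the second variable.\<close>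

class complex_inner = complex_normed_vector +
  fixes cinner :: "'a \<Rightarrow> 'a \<Rightarrow> complex"
  assumes cinner_commute: "cinner x y = cnj (cinner y x)"
    and cinner_add_right: "cinner x (y + z) = cinner x y + cinner x z"
    and cinner_scaleC_right: "cinner x (c *\<^sub>C y) = c * cinner x y"
    and cinner_self_nonneg: "cinner x x \<in> \<real>\<^sub>\<ge>\<^sub>0"
    and norm_eq_sqrt_cinner: "norm x = sqrt (Re (cinner x x))"

class chilbert_space = complex_inner + banach

global_interpretation complex_vector: vector_space "scaleC :: complex \<Rightarrow> 'a \<Rightarrow> 'a::complex_vector"
proof
  fix c d :: complex and x y :: 'a
  show "c *\<^sub>C (x + y) = c *\<^sub>C x + c *\<^sub>C y" by (rule scaleC_add_right)
  show "(c + d) *\<^sub>C x = c *\<^sub>C x + d *\<^sub>C x" by (rule scaleC_add_left)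
  show "c *\<^sub>C d *\<^sub>C x = (c * d) *\<^sub>C x" by (rule scaleC_scaleC)
  show "1 *\<^sub>C x = x" using scaleC_of_real[of 1 x] by simp
qed

definition closed_cspan :: "'a::complex_normed_vector set \<Rightarrow> 'a set" where
  "closed_cspan S = closure (complex_vector.span S)"

abbreviation clinear :: "('a::complex_vector \<Rightarrow> 'b::complex_vector) \<Rightarrow> bool" where
  "clinear f \<equiv> Vector_Spaces.linear scaleC scaleC f"

definition bounded_clinear ::
  "('a::complex_normed_vector \<Rightarrow> 'b::complex_normed_vector) \<Rightarrow> bool" where
  "bounded_clinear f \<longleftrightarrow> clinear f \<and> (\<exists>K. \<forall>x. norm (f x) \<le> norm x * K)"

lemma clinear_iff:
  "clinear f \<longleftrightarrow> (\<forall>x y. f (x + y) = f x + f y) \<and> (\<forall>c x. f (c *\<^sub>C x) = c *\<^sub>C f x)"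
  by (simp add: Vector_Spaces.linear_iff complex_vector.vector_space_axioms)

lemma bounded_clinear_iff:
  "bounded_clinear f \<longleftrightarrow> bounded_linear f \<and> (\<forall>c x. f (c *\<^sub>C x) = c *\<^sub>C f x)"
proof
  assume f: "bounded_clinear f"
  have "f (r *\<^sub>R x) = r *\<^sub>R f x" for r x
    using f by (simp add: bounded_clinear_def clinear_iff flip: scaleC_of_real)
  then show "bounded_linear f \<and> (\<forall>c x. f (c *\<^sub>C x) = c *\<^sub>C f x)"
    using f by (auto simp: bounded_clinear_def clinear_iff intro: bounded_linear_intro)
next
  assume "bounded_linear f \<and> (\<forall>c x. f (c *\<^sub>C x) = c *\<^sub>C f x)"
  then show "bounded_clinear f"
    by (auto simp: bounded_clinear_def clinear_iff bounded_linear.bounded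
        linear_add[OF bounded_linear.linear])
qed

typedef (overloaded) ('a, 'b) cblinfun (\<open>(_ \<Rightarrow>\<^sub>C\<^sub>L /_)\<close> [22, 21] 21) =
  "{f :: 'a::complex_normed_vector \<Rightarrow> 'b::complex_normed_vector. bounded_clinear f}"
  morphisms cblinfun_apply CBlinfun
  by (rule exI[of _ "\<lambda>_. 0"]) (simp add: bounded_clinear_iff bounded_linear_zero)

notation cblinfun_apply (infixr \<open>*\<^sub>V\<close> 70)

setup_lifting type_definition_cblinfun

lemma bounded_linear_cblinfun_apply: "bounded_linear (cblinfun_apply T)"
  using cblinfun_apply[of T] by (simp add: bounded_clinear_iff)

instantiation cblinfun :: (complex_normed_vector, complex_normed_vector) real_normed_vector
begin

lift_definition zero_cblinfun :: "'a \<Rightarrow>\<^sub>C\<^sub>L 'b" is "\<lambda>_. 0"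
  by (simp add: bounded_clinear_iff bounded_linear_zero)

lift_definition plus_cblinfun :: "'a \<Rightarrow>\<^sub>C\<^sub>L 'b \<Rightarrow> 'a \<Rightarrow>\<^sub>C\<^sub>L 'b \<Rightarrow> 'a \<Rightarrow>\<^sub>C\<^sub>L 'b"
  is "\<lambda>f g x. f x + g x"
  by (simp add: bounded_clinear_iff bounded_linear_add scaleC_add_right)

lift_definition uminus_cblinfun :: "'a \<Rightarrow>\<^sub>C\<^sub>L 'b \<Rightarrow> 'a \<Rightarrow>\<^sub>C\<^sub>L 'b" is "\<lambda>f x. - f x"
  by (simp add: bounded_clinear_iff bounded_linear_minus)

lift_definition minus_cblinfun :: "'a \<Rightarrow>\<^sub>C\<^sub>L 'b \<Rightarrow> 'a \<Rightarrow>\<^sub>C\<^sub>L 'b \<Rightarrow> 'a \<Rightarrow>\<^sub>C\<^sub>L 'b"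
  is "\<lambda>f g x. f x - g x"
  by (simp add: bounded_clinear_iff bounded_linear_sub complex_vector.scale_right_diff_distrib)

lift_definition scaleR_cblinfun :: "real \<Rightarrow> 'a \<Rightarrow>\<^sub>C\<^sub>L 'b \<Rightarrow> 'a \<Rightarrow>\<^sub>C\<^sub>L 'b" is "\<lambda>r f x. r *\<^sub>R f x"
  by (auto simp: bounded_clinear_iff scaleC_scaleC mult.commute
      intro: bounded_linear_const_scaleR simp flip: scaleC_of_real)
    (simp add: scaleC_of_real bounded_linear_const_scaleR)

lift_definition norm_cblinfun :: "'a \<Rightarrow>\<^sub>C\<^sub>L 'b \<Rightarrow> real" is onorm .

definition dist_cblinfun :: "'a \<Rightarrow>\<^sub>C\<^sub>L 'b \<Rightarrow> 'a \<Rightarrow>\<^sub>C\<^sub>L 'b \<Rightarrow> real" where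
  "dist_cblinfun S T = norm (S - T)"

definition sgn_cblinfun :: "'a \<Rightarrow>\<^sub>C\<^sub>L 'b \<Rightarrow> 'a \<Rightarrow>\<^sub>C\<^sub>L 'b" where
  "sgn_cblinfun T = inverse (norm T) *\<^sub>R T"

definition uniformity_cblinfun :: "(('a \<Rightarrow>\<^sub>C\<^sub>L 'b) \<times> ('a \<Rightarrow>\<^sub>C\<^sub>L 'b)) filter" where
  [code del]: "uniformity_cblinfun = (INF e\<in>{0 <..}. principal {(S, T). dist S T < e})"

definition open_cblinfun :: "('a \<Rightarrow>\<^sub>C\<^sub>L 'b) set \<Rightarrow> bool" where
  [code del]: "open_cblinfun X \<longleftrightarrow>
     (\<forall>S\<in>X. \<forall>\<^sub>F (S', T) in uniformity. S' = S \<longrightarrow> T \<in> X)"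

instance
proof
  fix S T R :: "'a \<Rightarrow>\<^sub>C\<^sub>L 'b" and r s :: real and X :: "('a \<Rightarrow>\<^sub>C\<^sub>L 'b) set"
  show "S + T + R = S + (T + R)" "S + T = T + S" "0 + S = S" "- S + S = 0" "S - T = S + - T"
    "r *\<^sub>R (S + T) = r *\<^sub>R S + r *\<^sub>R T" "(r + s) *\<^sub>R S = r *\<^sub>R S + s *\<^sub>R S"
    "r *\<^sub>R s *\<^sub>R S = (r * s) *\<^sub>R S" "1 *\<^sub>R S = S"
    by (transfer; simp add: algebra_simps)+
  show "dist S T = norm (S - T)" by (simp add: dist_cblinfun_def)
  show "sgn S = inverse (norm S) *\<^sub>R S" by (simp add: sgn_cblinfun_def)
  show "uniformity = (INF e\<in>{0 <..}. principal {(S, T :: 'a \<Rightarrow>\<^sub>C\<^sub>L 'b). dist S T < e})"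
    by (simp add: uniformity_cblinfun_def)
  show "open X \<longleftrightarrow> (\<forall>S\<in>X. \<forall>\<^sub>F (S', T) in uniformity. S' = S \<longrightarrow> T \<in> X)"
    by (simp add: open_cblinfun_def)
  show "norm S = 0 \<longleftrightarrow> S = 0"
    by transfer (simp add: bounded_clinear_iff onorm_eq_0 fun_eq_iff)
  show "norm (S + T) \<le> norm S + norm T"
    by transfer (simp add: bounded_clinear_iff onorm_triangle)
  show "norm (r *\<^sub>R S) = \<bar>r\<bar> * norm S"
    by transfer (simp add: bounded_clinear_iff onorm_scaleR)
qed

end

instantiation cblinfun :: (complex_normed_vector, complex_normed_vector) complex_normed_vector
begin

lift_definition scaleC_cblinfun :: "complex \<Rightarrow> 'a \<Rightarrow>\<^sub>C\<^sub>L 'b \<Rightarrow> 'a \<Rightarrow>\<^sub>C\<^sub>L 'b" is "\<lambda>c f x. c *\<^sub>C f x"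
proof -
  fix c :: complex and f :: "'a \<Rightarrow> 'b"
  assume f: "bounded_clinear f"
  have "bounded_linear (\<lambda>y::'b. c *\<^sub>C y)"
    by (rule bounded_linear_intro[where K = "cmod c"])
      (simp_all add: scaleC_add_right norm_scaleC scaleC_scaleC mult.commute flip: scaleC_of_real)
  then show "bounded_clinear (\<lambda>x. c *\<^sub>C f x)"
    using f by (auto simp: bounded_clinear_iff scaleC_scaleC mult.commute
        intro: bounded_linear_compose)
qed

instance
proof
  fix S T :: "'a \<Rightarrow>\<^sub>C\<^sub>L 'b" and c d :: complex and r :: real
  show "c *\<^sub>C (S + T) = c *\<^sub>C S + c *\<^sub>C T" by transfer (simp add: scaleC_add_right)
  show "(c + d) *\<^sub>C S = c *\<^sub>C S + d *\<^sub>C S" by transfer (simp add: scaleC_add_left)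
  show "c *\<^sub>C d *\<^sub>C S = (c * d) *\<^sub>C S" by transfer (simp add: scaleC_scaleC)
  show "complex_of_real r *\<^sub>C S = r *\<^sub>R S" by transfer (simp add: scaleC_of_real)
  show "norm (c *\<^sub>C S) = cmod c * norm S"
  proof transfer
    fix c and f :: "'a \<Rightarrow> 'b"
    assume "bounded_clinear f"
    then have "onorm (\<lambda>x. cmod c *\<^sub>R f x) = cmod c * onorm f"
      by (simp add: bounded_clinear_iff onorm_scaleR)
    then show "onorm (\<lambda>x. c *\<^sub>C f x) = cmod c * onorm f"
      by (simp add: onorm_def norm_scaleC)
  qed
qed

end

lift_definition cblinfun_id :: "'a::complex_normed_vector \<Rightarrow>\<^sub>C\<^sub>L 'a" is "\<lambda>x. x"
  by (simp add: bounded_clinear_iff bounded_linear_ident)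

lift_definition cblinfun_compose ::
  "'b::complex_normed_vector \<Rightarrow>\<^sub>C\<^sub>L 'c::complex_normed_vector \<Rightarrow>
   'a::complex_normed_vector \<Rightarrow>\<^sub>C\<^sub>L 'b \<Rightarrow> 'a \<Rightarrow>\<^sub>C\<^sub>L 'c" (infixl \<open>o\<^sub>C\<close> 67)
  is "\<lambda>f g x. f (g x)"
  by (simp add: bounded_clinear_iff bounded_linear_compose)

text \<open>The adjoint exists and is unique by the Riesz representation theorem.\<close>

definition adjoint :: "'a::chilbert_space \<Rightarrow>\<^sub>C\<^sub>L 'b::chilbert_space \<Rightarrow> 'b \<Rightarrow>\<^sub>C\<^sub>L 'a" where
  "adjoint T = (THE S. \<forall>x y. cinner (S *\<^sub>V y) x = cinner y (T *\<^sub>V x))"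

definition unitary :: "'a::chilbert_space \<Rightarrow>\<^sub>C\<^sub>L 'b::chilbert_space \<Rightarrow> bool" where
  "unitary U \<longleftrightarrow> adjoint U o\<^sub>C U = cblinfun_id \<and> U o\<^sub>C adjoint U = cblinfun_id"

definition coisometry :: "'a::chilbert_space \<Rightarrow>\<^sub>C\<^sub>L 'b::chilbert_space \<Rightarrow> bool" where
  "coisometry W \<longleftrightarrow> W o\<^sub>C adjoint W = cblinfun_id"

text \<open>An operator matrix \<open>[T i j]\<close> with \<open>i, j < n\<close> is regarded as an operator on the \<open>n\<close>-fold
  Hilbert sum, a vector of which is given by its components \<open>h i\<close>, \<open>i < n\<close>.\<close>

definition pos_op_matrix :: "nat \<Rightarrow> (nat \<Rightarrow> nat \<Rightarrow> 'h::chilbert_space \<Rightarrow>\<^sub>C\<^sub>L 'h) \<Rightarrow> bool" where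
  "pos_op_matrix n T \<longleftrightarrow>
     (\<forall>h. (\<Sum>i<n. cinner (h i) (\<Sum>j<n. T i j *\<^sub>V h j)) \<in> \<real>\<^sub>\<ge>\<^sub>0)"

definition le_op_matrix :: "nat \<Rightarrow> (nat \<Rightarrow> nat \<Rightarrow> 'h::chilbert_space \<Rightarrow>\<^sub>C\<^sub>L 'h) \<Rightarrow>
    (nat \<Rightarrow> nat \<Rightarrow> 'h \<Rightarrow>\<^sub>C\<^sub>L 'h) \<Rightarrow> bool" where
  "le_op_matrix n S T \<longleftrightarrow> pos_op_matrix n (\<lambda>i j. T i j - S i j)"


section \<open>\<open>C\<^sup>*\<close>-algebras and Hilbert \<open>C\<^sup>*\<close>-modules\<close>

class cstar_algebra = complex_normed_vector + real_normed_algebra + banach +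
  fixes star :: "'a \<Rightarrow> 'a"
  assumes mult_scaleC_left: "(c *\<^sub>C a) * b = c *\<^sub>C (a * b)"
    and mult_scaleC_right: "a * (c *\<^sub>C b) = c *\<^sub>C (a * b)"
    and star_star: "star (star a) = a"
    and star_add: "star (a + b) = star a + star b"
    and star_scaleC: "star (c *\<^sub>C a) = cnj c *\<^sub>C star a"
    and star_mult: "star (a * b) = star b * star a"
    and norm_star_mult_self: "norm (star a * a) = (norm a)\<^sup>2"

text \<open>The condition \<open>0 \<noteq> 1\<close> is deliberately not imposed, so that the zero algebra is unital.\<close>

class unital_cstar_algebra = cstar_algebra + monoid_mult

definition star_automorphism :: "('a::cstar_algebra \<Rightarrow> 'a) \<Rightarrow> bool" where
  "star_automorphism \<beta> \<longleftrightarrow> bij \<beta> \<and> clinear \<beta> \<and>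
     (\<forall>a b. \<beta> (a * b) = \<beta> a * \<beta> b) \<and> (\<forall>a. \<beta> (star a) = star (\<beta> a))"

text \<open>The norm and the completeness of a Hilbert module are those of the type of its elements.\<close>

locale hilbert_module =
  fixes act :: "'x::{complex_normed_vector, banach} \<Rightarrow> 'a::cstar_algebra \<Rightarrow> 'x"
    and ip :: "'x \<Rightarrow> 'x \<Rightarrow> 'a"
  assumes act_add_left: "act (x + y) a = act x a + act y a"
    and act_add_right: "act x (a + b) = act x a + act x b"
    and act_mult: "act x (a * b) = act (act x a) b"
    and act_scaleC_left: "act (c *\<^sub>C x) a = c *\<^sub>C act x a"
    and act_scaleC_right: "act x (c *\<^sub>C a) = c *\<^sub>C act x a"
    and ip_add_right: "ip x (y + z) = ip x y + ip x z"
    and ip_scaleC_right: "ip x (c *\<^sub>C y) = c *\<^sub>C ip x y"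
    and ip_act_right: "ip x (act y a) = ip x y * a"
    and ip_star: "star (ip x y) = ip y x"
    and ip_self_positive: "\<exists>b. ip x x = star b * b"
    and norm_eq_sqrt_ip: "norm x = sqrt (norm (ip x x))"

locale full_hilbert_module = hilbert_module +
  assumes full: "closed_cspan {ip x y | x y. True} = UNIV"

definition module_isomorphism ::
  "('x \<Rightarrow> 'x \<Rightarrow> 'a::cstar_algebra) \<Rightarrow> ('x::complex_normed_vector \<Rightarrow> 'x) \<Rightarrow> bool" where
  "module_isomorphism ip \<theta> \<longleftrightarrow> bij \<theta> \<and> clinear \<theta> \<and>
     (\<exists>\<beta>. star_automorphism \<beta> \<and> (\<forall>x y. ip (\<theta> x) (\<theta> y) = \<beta> (ip x y)))"

text \<open>Groups are written additively, but are not assumed to be commutative.\<close>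

definition module_action ::
  "('x \<Rightarrow> 'x \<Rightarrow> 'a::cstar_algebra) \<Rightarrow>
   ('g::topological_group_add \<Rightarrow> 'x::complex_normed_vector \<Rightarrow> 'x) \<Rightarrow> bool" where
  "module_action ip \<eta> \<longleftrightarrow>
     (\<forall>t. module_isomorphism ip (\<eta> t)) \<and>
     (\<forall>t s. \<eta> (t + s) = \<eta> t \<circ> \<eta> s) \<and>
     (\<forall>x. continuous_on UNIV (\<lambda>t. \<eta> t x))"

text \<open>The automorphism is unique if the module is full.\<close>

definition induced_action ::
  "('x \<Rightarrow> 'x \<Rightarrow> 'a::cstar_algebra) \<Rightarrow> ('g \<Rightarrow> 'x \<Rightarrow> 'x) \<Rightarrow> 'g \<Rightarrow> 'a \<Rightarrow> 'a" where
  "induced_action ip \<eta> t =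
     (THE \<beta>. star_automorphism \<beta> \<and> (\<forall>x y. \<beta> (ip x y) = ip (\<eta> t x) (\<eta> t y)))"


section \<open>Krein structures\<close>

definition krein_cstar_algebra :: "('a::cstar_algebra \<Rightarrow> 'a) \<Rightarrow> bool" where
  "krein_cstar_algebra \<alpha> \<longleftrightarrow> star_automorphism \<alpha> \<and> \<alpha> \<circ> \<alpha> = id"

definition ksharp :: "('a::cstar_algebra \<Rightarrow> 'a) \<Rightarrow> 'a \<Rightarrow> 'a" where
  "ksharp \<alpha> a = \<alpha> (star a)"

definition krein_space :: "('h::chilbert_space \<Rightarrow>\<^sub>C\<^sub>L 'h) \<Rightarrow> bool" where
  "krein_space J \<longleftrightarrow> adjoint J = J \<and> J o\<^sub>C J = cblinfun_id"

text \<open>\<open>kadj J J' T\<close> is the Krein adjoint of \<open>T\<close>, viewed as an operator from the Krein space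
  with symmetry \<open>J\<close> to the Krein space with symmetry \<open>J'\<close>.\<close>

definition kadj :: "('h::chilbert_space \<Rightarrow>\<^sub>C\<^sub>L 'h) \<Rightarrow> ('k::chilbert_space \<Rightarrow>\<^sub>C\<^sub>L 'k) \<Rightarrow>
    ('h \<Rightarrow>\<^sub>C\<^sub>L 'k) \<Rightarrow> ('k \<Rightarrow>\<^sub>C\<^sub>L 'h)" where
  "kadj J J' T = J o\<^sub>C adjoint T o\<^sub>C J'"

definition alpha_CP :: "('a::cstar_algebra \<Rightarrow> 'a) \<Rightarrow> ('h::chilbert_space \<Rightarrow>\<^sub>C\<^sub>L 'h) \<Rightarrow>
    ('a \<Rightarrow> 'h \<Rightarrow>\<^sub>C\<^sub>L 'h) \<Rightarrow> bool" where
  "alpha_CP \<alpha> J \<phi> \<longleftrightarrow>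
     bounded_clinear \<phi> \<and>
     (\<forall>a. \<phi> (star a) = adjoint (\<phi> a)) \<and>
     (\<forall>a. \<phi> (\<alpha> a) = J o\<^sub>C \<phi> a o\<^sub>C J \<and> J o\<^sub>C \<phi> a o\<^sub>C J = \<phi> a) \<and>
     (\<forall>n\<ge>1. \<forall>x. pos_op_matrix n (\<lambda>i j. \<phi> (ksharp \<alpha> (x i) * x j))) \<and>
     (\<forall>a. \<exists>M>0. \<forall>n\<ge>1. \<forall>x.
        le_op_matrix n (\<lambda>i j. \<phi> (ksharp \<alpha> (a * x i) * (a * x j)))
                       (\<lambda>i j. M *\<^sub>R \<phi> (ksharp \<alpha> (x i) * x j)))"

definition phi_map :: "('x \<Rightarrow> 'x \<Rightarrow> 'a::cstar_algebra) \<Rightarrow>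
    ('h1::chilbert_space \<Rightarrow>\<^sub>C\<^sub>L 'h1) \<Rightarrow> ('h2::chilbert_space \<Rightarrow>\<^sub>C\<^sub>L 'h2) \<Rightarrow>
    ('a \<Rightarrow> 'h1 \<Rightarrow>\<^sub>C\<^sub>L 'h1) \<Rightarrow> ('x::complex_normed_vector \<Rightarrow> 'h1 \<Rightarrow>\<^sub>C\<^sub>L 'h2) \<Rightarrow> bool" where
  "phi_map ip J1 J2 \<phi> \<Phi> \<longleftrightarrow>
     bounded_clinear \<Phi> \<and> (\<forall>x y. kadj J1 J2 (\<Phi> x) o\<^sub>C \<Phi> y = \<phi> (ip x y))"

definition krein_representation :: "('k::chilbert_space \<Rightarrow>\<^sub>C\<^sub>L 'k) \<Rightarrow>
    ('a::cstar_algebra \<Rightarrow> 'k \<Rightarrow>\<^sub>C\<^sub>L 'k) \<Rightarrow> bool" where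
  "krein_representation J \<pi> \<longleftrightarrow>
     bounded_clinear \<pi> \<and>
     (\<forall>a b. \<pi> (a * b) = \<pi> a o\<^sub>C \<pi> b) \<and>
     (\<forall>a. \<pi> (star a) = kadj J J (\<pi> a))"

definition module_representation :: "('x \<Rightarrow> 'x \<Rightarrow> 'a::cstar_algebra) \<Rightarrow>
    ('k1::chilbert_space \<Rightarrow>\<^sub>C\<^sub>L 'k1) \<Rightarrow> ('k2::chilbert_space \<Rightarrow>\<^sub>C\<^sub>L 'k2) \<Rightarrow>
    ('a \<Rightarrow> 'k1 \<Rightarrow>\<^sub>C\<^sub>L 'k1) \<Rightarrow> ('x::complex_normed_vector \<Rightarrow> 'k1 \<Rightarrow>\<^sub>C\<^sub>L 'k2) \<Rightarrow> bool" where
  "module_representation ip J3 J4 \<pi>A \<pi>X \<longleftrightarrow>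
     bounded_clinear \<pi>X \<and> (\<forall>x y. kadj J3 J4 (\<pi>X x) o\<^sub>C \<pi>X y = \<pi>A (ip x y))"

definition pseudo_unitary_rep :: "('h::chilbert_space \<Rightarrow>\<^sub>C\<^sub>L 'h) \<Rightarrow>
    ('g::group_add \<Rightarrow> 'h \<Rightarrow>\<^sub>C\<^sub>L 'h) \<Rightarrow> bool" where
  "pseudo_unitary_rep J u \<longleftrightarrow>
     u 0 = cblinfun_id \<and> (\<forall>t s. u (t + s) = u t o\<^sub>C u s) \<and> (\<forall>t. u (- t) = kadj J J (u t))"

definition unitary_pseudo_unitary_rep :: "('h::chilbert_space \<Rightarrow>\<^sub>C\<^sub>L 'h) \<Rightarrow>
    ('g::group_add \<Rightarrow> 'h \<Rightarrow>\<^sub>C\<^sub>L 'h) \<Rightarrow> bool" where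
  "unitary_pseudo_unitary_rep J u \<longleftrightarrow> pseudo_unitary_rep J u \<and> (\<forall>t. unitary (u t))"

text \<open>\<open>F (\<eta> t x) = u' t F(x) (u t)\<^sup>#\<close>; the Krein adjoint of \<open>u t\<close> only involves the
  symmetry of its own space.\<close>

definition covariant :: "('h1::chilbert_space \<Rightarrow>\<^sub>C\<^sub>L 'h1) \<Rightarrow> ('g \<Rightarrow> 'x \<Rightarrow> 'x) \<Rightarrow>
    ('g \<Rightarrow> 'h2::chilbert_space \<Rightarrow>\<^sub>C\<^sub>L 'h2) \<Rightarrow> ('g \<Rightarrow> 'h1 \<Rightarrow>\<^sub>C\<^sub>L 'h1) \<Rightarrow>
    ('x \<Rightarrow> 'h1 \<Rightarrow>\<^sub>C\<^sub>L 'h2) \<Rightarrow> bool" where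
  "covariant J \<eta> u' u F \<longleftrightarrow> (\<forall>t x. F (\<eta> t x) = u' t o\<^sub>C F x o\<^sub>C kadj J J (u t))"

definition covariant_phi_map :: "('a::cstar_algebra \<Rightarrow> 'a) \<Rightarrow> ('x \<Rightarrow> 'x \<Rightarrow> 'a) \<Rightarrow>
    ('g \<Rightarrow> 'x \<Rightarrow> 'x) \<Rightarrow> ('h1::chilbert_space \<Rightarrow>\<^sub>C\<^sub>L 'h1) \<Rightarrow> ('h2::chilbert_space \<Rightarrow>\<^sub>C\<^sub>L 'h2) \<Rightarrow>
    ('g \<Rightarrow> 'h2 \<Rightarrow>\<^sub>C\<^sub>L 'h2) \<Rightarrow> ('g \<Rightarrow> 'h1 \<Rightarrow>\<^sub>C\<^sub>L 'h1) \<Rightarrow> ('a \<Rightarrow> 'h1 \<Rightarrow>\<^sub>C\<^sub>L 'h1) \<Rightarrow>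
    ('x::complex_normed_vector \<Rightarrow> 'h1 \<Rightarrow>\<^sub>C\<^sub>L 'h2) \<Rightarrow> bool" where
  "covariant_phi_map \<alpha> ip \<eta> J1 J2 u' u \<phi> \<Phi> \<longleftrightarrow>
     phi_map ip J1 J2 \<phi> \<Phi> \<and> covariant J1 \<eta> u' u \<Phi> \<and>
     (\<forall>t. induced_action ip \<eta> t \<circ> \<alpha> = \<alpha> \<circ> induced_action ip \<eta> t)"

definition covariant_KSGNS ::
  "('a::cstar_algebra \<Rightarrow> 'a) \<Rightarrow> ('x \<Rightarrow> 'x \<Rightarrow> 'a) \<Rightarrow> ('g::group_add \<Rightarrow> 'x \<Rightarrow> 'x) \<Rightarrow>
   ('h1::chilbert_space \<Rightarrow>\<^sub>C\<^sub>L 'h1) \<Rightarrow> ('h2::chilbert_space \<Rightarrow>\<^sub>C\<^sub>L 'h2) \<Rightarrow>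
   ('g \<Rightarrow> 'h1 \<Rightarrow>\<^sub>C\<^sub>L 'h1) \<Rightarrow> ('g \<Rightarrow> 'h2 \<Rightarrow>\<^sub>C\<^sub>L 'h2) \<Rightarrow>
   ('a \<Rightarrow> 'h1 \<Rightarrow>\<^sub>C\<^sub>L 'h1) \<Rightarrow> ('x::complex_normed_vector \<Rightarrow> 'h1 \<Rightarrow>\<^sub>C\<^sub>L 'h2) \<Rightarrow>
   ('x \<Rightarrow> 'k1::chilbert_space \<Rightarrow>\<^sub>C\<^sub>L 'k2::chilbert_space) \<Rightarrow> ('a \<Rightarrow> 'k1 \<Rightarrow>\<^sub>C\<^sub>L 'k1) \<Rightarrow>
   ('h1 \<Rightarrow>\<^sub>C\<^sub>L 'k1) \<Rightarrow> ('h2 \<Rightarrow>\<^sub>C\<^sub>L 'k2) \<Rightarrow> ('g \<Rightarrow> 'k1 \<Rightarrow>\<^sub>C\<^sub>L 'k1) \<Rightarrow> ('g \<Rightarrow> 'k2 \<Rightarrow>\<^sub>C\<^sub>L 'k2) \<Rightarrow>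
   ('k1 \<Rightarrow>\<^sub>C\<^sub>L 'k1) \<Rightarrow> ('k2 \<Rightarrow>\<^sub>C\<^sub>L 'k2) \<Rightarrow> bool" where
  "covariant_KSGNS \<alpha> ip \<eta> J1 J2 u u' \<phi> \<Phi> \<pi>X \<pi>A V W v v' J3 J4 \<longleftrightarrow>
     krein_space J3 \<and> krein_space J4 \<and>
     pseudo_unitary_rep J3 v \<and> pseudo_unitary_rep J4 v' \<and>
     krein_representation J3 \<pi>A \<and>
     module_representation ip J3 J4 \<pi>A \<pi>X \<and>
     covariant J3 \<eta> v' v \<pi>X \<and>
     kadj J1 J3 V = adjoint V \<and>
     (\<forall>a. \<pi>A (\<alpha> a) o\<^sub>C V = J3 o\<^sub>C \<pi>A a o\<^sub>C V o\<^sub>C J1) \<and>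
     coisometry W \<and> kadj J2 J4 W = adjoint W \<and>
     (\<forall>a. \<phi> a = kadj J1 J3 V o\<^sub>C \<pi>A a o\<^sub>C V) \<and>
     (\<forall>x. \<Phi> x = kadj J2 J4 W o\<^sub>C \<pi>X x o\<^sub>C V) \<and>
     (\<forall>t. kadj J3 J3 (v t) = adjoint (v t)) \<and>
     (\<forall>t. kadj J4 J4 (v' t) = adjoint (v' t)) \<and>
     (\<forall>t. V o\<^sub>C u t = v t o\<^sub>C V) \<and>
     (\<forall>t. W o\<^sub>C u' t = v' t o\<^sub>C W)"

definition minimal_KSGNS :: "('x \<Rightarrow> 'k1::chilbert_space \<Rightarrow>\<^sub>C\<^sub>L 'k2::chilbert_space) \<Rightarrow>
    ('a \<Rightarrow> 'k1 \<Rightarrow>\<^sub>C\<^sub>L 'k1) \<Rightarrow> ('h1::chilbert_space \<Rightarrow>\<^sub>C\<^sub>L 'k1) \<Rightarrow> bool" where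
  "minimal_KSGNS \<pi>X \<pi>A V \<longleftrightarrow>
     closed_cspan {\<pi>X x *\<^sub>V V *\<^sub>V h | x h. True} = UNIV \<and>
     closed_cspan {\<pi>A a *\<^sub>V V *\<^sub>V h | a h. True} = UNIV"

end

theory Submission
  imports Defs
begin

text \<open>A minimal construction is determined by the Gram matrices of the two total families
  \<open>\<pi>A a (V h)\<close> in the first space and \<open>\<pi>X x (V h)\<close> in the second. Both matrices can
  be computed from \<open>\<phi>\<close>, \<open>\<Phi>\<close>, \<open>\<alpha>\<close> and \<open>J1\<close> alone. For the first family, \<open>J3\<close> moves past
  \<open>\<pi>A b\<close> by the relation between \<open>\<pi>A (\<alpha> b) V\<close> and \<open>J3 (\<pi>A b) V J1\<close>, which turns the Hilbert
  adjoint of \<open>\<pi>A a\<close> into \<open>\<pi>A (star a)\<close> and leaves a compression of \<open>\<pi>A\<close> to \<open>V\<close>, that is,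
  a value of \<open>\<phi>\<close> (\<open>gram_\<pi>A\<close>). For the second, the adjoint of the coisometry \<open>W\<close> is an isometry
  carrying \<open>\<pi>X x V\<close> to \<open>\<Phi> x\<close> (\<open>gram_\<pi>X\<close>). Total families with equal Gram matrices are related
  by a unitary operator (\<open>unitary_of_equal_gram\<close>), and this gives \<open>U1\<close> and \<open>U2\<close>.

  Every relation claimed for \<open>U1\<close> and \<open>U2\<close> is an equality of operators and is checked on one of
  the total families, on which all the operators act by formulas of the same shape in every
  construction: \<open>J3\<close> by \<open>\<alpha>\<close> and \<open>J1\<close> (\<open>J3_\<pi>A_V\<close>), \<open>\<pi>X x\<close> by the module
  action (\<open>\<pi>X_act\<close>), \<open>v' t\<close> by \<open>\<eta> t\<close> and \<open>u t\<close> (\<open>v'_\<pi>X_V\<close>), the adjoint of \<open>W\<close>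
  by \<open>\<Phi>\<close>. For \<open>v t\<close> such a formula is at hand when \<open>a\<close> is an inner product
  (\<open>v_\<pi>A_ip_V\<close>), and fullness of the module extends the conclusion to all \<open>a\<close>. Since \<open>U1\<close>
  commutes with the symmetries and \<open>J4\<close> is forced to be the identity (\<open>J4_eq_id\<close>), Krein adjoints
  of \<open>U1\<close> and \<open>U2\<close> are their inverses.\<close>

section \<open>Inner products\<close>

lemma cinner_add_left: "cinner (x + y) z = cinner x z + cinner y (z :: 'a::complex_inner)"
  by (subst (1 2 3) cinner_commute) (simp add: cinner_add_right)

lemma cinner_scaleC_left: "cinner (c *\<^sub>C x) y = cnj c * cinner x (y :: 'a::complex_inner)"
  by (subst (1 2) cinner_commute) (simp add: cinner_scaleC_right)

lemma cinner_scaleR_right: "cinner x (r *\<^sub>R y) = of_real r * cinner x (y :: 'a::complex_inner)"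
  by (simp add: cinner_scaleC_right flip: scaleC_of_real)

lemma cinner_zero_right [simp]: "cinner x (0 :: 'a::complex_inner) = 0"
  using cinner_add_right[of x 0 0] by simp

lemma cinner_zero_left [simp]: "cinner (0 :: 'a::complex_inner) x = 0"
  using cinner_add_left[of 0 0 x] by simp

lemma cinner_diff_right: "cinner x (y - z) = cinner x y - cinner x (z :: 'a::complex_inner)"
  using cinner_add_right[of x "y - z" z] by simp

lemma cinner_diff_left: "cinner (x - y) z = cinner x z - cinner y (z :: 'a::complex_inner)"
  using cinner_add_left[of "x - y" y z] by simp

lemma Re_cinner_commute: "Re (cinner x y) = Re (cinner y (x :: 'a::complex_inner))"
  by (subst cinner_commute) simp

lemma norm_sq_eq_cinner: "(norm x)\<^sup>2 = Re (cinner x (x :: 'a::complex_inner))"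
  using cinner_self_nonneg[of x] by (simp add: norm_eq_sqrt_cinner complex_nonneg_Reals_iff)

lemma cinner_self_eq_0: "cinner x x = 0 \<Longrightarrow> (x :: 'a::complex_inner) = 0"
  using norm_sq_eq_cinner[of x] by simp

lemma norm_add_sq:
  "(norm (x + y))\<^sup>2 = (norm x)\<^sup>2 + (norm y)\<^sup>2 + 2 * Re (cinner x (y :: 'a::complex_inner))"
  using Re_cinner_commute[of x y]
  by (simp add: norm_sq_eq_cinner cinner_add_left cinner_add_right)

lemma norm_diff_sq:
  "(norm (x - y))\<^sup>2 = (norm x)\<^sup>2 + (norm y)\<^sup>2 - 2 * Re (cinner x (y :: 'a::complex_inner))"
  using Re_cinner_commute[of x y]
  by (simp add: norm_sq_eq_cinner cinner_diff_left cinner_diff_right)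

text \<open>The norm is already known to satisfy the triangle inequality, and squaring it gives
  the real part of the Cauchy--Schwarz inequality.\<close>

lemma Re_cinner_le: "Re (cinner x y) \<le> norm x * norm (y :: 'a::complex_inner)"
proof -
  have "(norm (x + y))\<^sup>2 \<le> (norm x + norm y)\<^sup>2"
    by (simp add: norm_triangle_ineq power_mono)
  then show ?thesis by (simp add: norm_add_sq power2_sum)
qed

lemma abs_Re_cinner_le: "\<bar>Re (cinner x y)\<bar> \<le> norm x * norm (y :: 'a::complex_inner)"
  using Re_cinner_le[of x y] Re_cinner_le[of x "- y"] cinner_diff_right[of x 0 y] by simp

lemma cinner_eqI:
  fixes x :: "'a::complex_inner"
  assumes "\<And>z. cinner x z = cinner y z"
  shows "x = y"
  using cinner_self_eq_0[of "x - y"] assms[of "x - y"] by (simp add: cinner_diff_left)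

lemma Im_cinner: "Im (cinner x y) = - Re (cinner x (\<i> *\<^sub>C (y :: 'a::complex_inner)))"
  by (simp add: cinner_scaleC_right)

section \<open>Adjoints\<close>

lemma bounded_clinear_cblinfun_apply: "bounded_clinear (cblinfun_apply T)"
  using cblinfun_apply[of T] by simp

lemma cblinfun_eqI: "(\<And>x. S *\<^sub>V x = T *\<^sub>V x) \<Longrightarrow> S = T"
  by (metis cblinfun_apply_inject ext)

lemmas cblinfun_simps = cblinfun_compose.rep_eq cblinfun_id.rep_eq

lemma cblinfun_add: "T *\<^sub>V (x + y) = T *\<^sub>V x + T *\<^sub>V y"
  using bounded_clinear_cblinfun_apply[of T] by (simp add: bounded_clinear_def clinear_iff)

lemma cblinfun_scaleC: "T *\<^sub>V (c *\<^sub>C x) = c *\<^sub>C (T *\<^sub>V x)"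
  using bounded_clinear_cblinfun_apply[of T] by (simp add: bounded_clinear_def clinear_iff)

lemma norm_cblinfun_apply_le: "norm (T *\<^sub>V x) \<le> norm T * norm x"
  unfolding norm_cblinfun.rep_eq by (rule onorm[OF bounded_linear_cblinfun_apply])

text \<open>The representing vector minimises \<open>(norm x)\<^sup>2 - 2 * g x\<close>: by the parallelogram law a
  minimising sequence is Cauchy, and the first variation at its limit vanishes. The statement uses
  a real functional because the real part of the inner product determines the rest.\<close>

lemma riesz_real:
  fixes g :: "'a::chilbert_space \<Rightarrow> real"
  assumes g: "bounded_linear g"
  shows "\<exists>z. \<forall>x. Re (cinner z x) = g x"
proof -
  interpret g: bounded_linear g by (rule g)
  obtain K where K: "\<And>x. norm (g x) \<le> norm x * K" using g.bounded by blast
  define Q where "Q x = (norm x)\<^sup>2 - 2 * g x" for x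
  define m where "m = Inf (range Q)"
  have "- K\<^sup>2 \<le> Q x" for x
  proof -
    have "0 \<le> (norm x - K)\<^sup>2" by simp
    with K[of x] show ?thesis by (simp add: Q_def power2_diff)
  qed
  then have bdd: "bdd_below (range Q)" unfolding bdd_below_def by blast
  have m_le: "m \<le> Q x" for x unfolding m_def by (rule cInf_lower[OF _ bdd]) simp
  have "\<exists>x. Q x < m + inverse (real (Suc n))" for n
    using cInf_lessD[of "range Q" "m + inverse (real (Suc n))"] by (auto simp: m_def)
  then obtain X where X: "\<And>n. Q (X n) < m + inverse (real (Suc n))" by metis
  \<comment> \<open>the defect of \<open>Q\<close> at a midpoint is a quarter of the squared distance\<close>
  have par: "(norm (x - y))\<^sup>2 \<le> 2 * (Q x - m) + 2 * (Q y - m)" for x y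
  proof -
    have "Q ((1/2) *\<^sub>R (x + y)) = (norm (x + y))\<^sup>2 / 4 - (g x + g y)"
      unfolding Q_def norm_scaleR power_mult_distrib by (simp add: power2_eq_square g.scaleR g.add field_simps)
    then have "m \<le> (norm (x + y))\<^sup>2 / 4 - (g x + g y)" using m_le by metis
    then show ?thesis unfolding Q_def norm_add_sq norm_diff_sq by argo
  qed
  have "Cauchy X"
  proof (rule metric_CauchyI)
    fix e :: real assume e: "0 < e"
    obtain N where N: "inverse (real (Suc N)) < e\<^sup>2 / 4"
      using reals_Archimedean[of "e\<^sup>2 / 4"] e by auto
    have "dist (X i) (X j) < e" if ij: "N \<le> i" "N \<le> j" for i j
    proof -
      have "Q (X k) - m < e\<^sup>2 / 4" if "N \<le> k" for k
      proof -
        have "inverse (real (Suc k)) \<le> inverse (real (Suc N))"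
          using that by (intro le_imp_inverse_le) auto
        with X[of k] N show ?thesis by linarith
      qed
      from this[OF ij(1)] this[OF ij(2)] have "(norm (X i - X j))\<^sup>2 < e\<^sup>2"
        using par[of "X i" "X j"] by argo
      then show ?thesis using e by (auto simp: dist_norm intro: power2_less_imp_less)
    qed
    then show "\<exists>N. \<forall>i\<ge>N. \<forall>j\<ge>N. dist (X i) (X j) < e" by blast
  qed
  then obtain z where z: "X \<longlonglongrightarrow> z" using Cauchy_convergent convergentD by blast
  have "(\<lambda>n. Q (X n)) \<longlonglongrightarrow> Q z" unfolding Q_def by (intro tendsto_intros g.tendsto z)
  moreover have "(\<lambda>n. m + inverse (real (Suc n))) \<longlonglongrightarrow> m + 0"
    by (intro tendsto_intros LIMSEQ_inverse_real_of_nat)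
  ultimately have "Q z \<le> m + 0"
    by (rule LIMSEQ_le) (use X less_imp_le in blast)
  then have zmin: "Q z \<le> Q x" for x using m_le[of x] by simp
  have "Re (cinner z x) = g x" for x
  proof -
    define d where "d = Re (cinner z x) - g x"
    have quad: "0 \<le> t\<^sup>2 * (norm x)\<^sup>2 + 2 * t * d" for t
      using zmin[of "z + t *\<^sub>R x"]
      by (simp add: Q_def d_def norm_add_sq cinner_scaleR_right g.add g.scaleR
          power_mult_distrib algebra_simps)
    have "d = 0"
    proof (rule ccontr)
      assume d: "d \<noteq> 0"
      \<comment> \<open>\<open>t\<close> minimises the quadratic with its leading coefficient raised to \<open>c\<close>, which is positive\<close>
      define c where "c = 1 + (norm x)\<^sup>2"
      define t where "t = - d / c"
      have c: "0 < c" by (simp add: c_def add_pos_nonneg)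
      have "t\<^sup>2 * (norm x)\<^sup>2 + 2 * t * d \<le> t * (t * c) + 2 * t * d"
        by (simp add: c_def power2_eq_square algebra_simps)
      also have "\<dots> = - (d * d / c)" using c by (simp add: t_def)
      also have "\<dots> < 0" using d c by (simp add: divide_pos_pos flip: power2_eq_square)
      finally show False using quad[of t] by simp
    qed
    then show ?thesis by (simp add: d_def)
  qed
  then show ?thesis by blast
qed

lemma adjoint_exists:
  fixes T :: "'a::chilbert_space \<Rightarrow>\<^sub>C\<^sub>L 'b::chilbert_space"
  shows "\<exists>S. \<forall>x y. cinner (S *\<^sub>V y) x = cinner y (T *\<^sub>V x)"
proof -
  have "\<exists>z. \<forall>x. cinner z x = cinner y (T *\<^sub>V x)" for y
  proof -
    have "bounded_linear (\<lambda>x. Re (cinner y (T *\<^sub>V x)))"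
    proof (rule bounded_linear_intro[where K = "norm y * norm T"])
      fix x x' :: 'a and r :: real
      show "Re (cinner y (T *\<^sub>V (x + x'))) = Re (cinner y (T *\<^sub>V x)) + Re (cinner y (T *\<^sub>V x'))"
        by (simp add: cblinfun_add cinner_add_right)
      show "Re (cinner y (T *\<^sub>V (r *\<^sub>R x))) = r *\<^sub>R Re (cinner y (T *\<^sub>V x))"
        by (simp add: cblinfun_scaleC cinner_scaleC_right flip: scaleC_of_real)
      have "\<bar>Re (cinner y (T *\<^sub>V x))\<bar> \<le> norm y * (norm T * norm x)"
        by (rule order_trans[OF abs_Re_cinner_le])
          (simp add: mult_left_mono norm_cblinfun_apply_le)
      then show "norm (Re (cinner y (T *\<^sub>V x))) \<le> norm x * (norm y * norm T)"
        by (simp add: mult_ac)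
    qed
    then obtain z where z: "\<And>x. Re (cinner z x) = Re (cinner y (T *\<^sub>V x))"
      using riesz_real by metis
    have "cinner z x = cinner y (T *\<^sub>V x)" for x
      using z[of x] z[of "\<i> *\<^sub>C x"] by (simp add: complex_eq_iff Im_cinner cblinfun_scaleC)
    then show ?thesis by blast
  qed
  then obtain s where s: "\<And>y x. cinner (s y) x = cinner y (T *\<^sub>V x)" by metis
  have "bounded_clinear s"
    unfolding bounded_clinear_def clinear_iff
  proof (intro conjI allI exI)
    fix y y' :: 'b and c
    show "s (y + y') = s y + s y'" by (rule cinner_eqI) (simp add: cinner_add_left s)
    show "s (c *\<^sub>C y) = c *\<^sub>C s y" by (rule cinner_eqI) (simp add: cinner_scaleC_left s)
    have "(norm (s y))\<^sup>2 \<le> norm y * norm (T *\<^sub>V s y)"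
      unfolding norm_sq_eq_cinner s by (rule Re_cinner_le)
    also have "\<dots> \<le> norm y * (norm T * norm (s y))"
      by (simp add: mult_left_mono norm_cblinfun_apply_le)
    finally show "norm (s y) \<le> norm y * norm T"
      by (cases "s y = 0") (simp_all add: power2_eq_square mult.assoc[symmetric])
  qed
  then show ?thesis using s by (intro exI[of _ "CBlinfun s"]) (simp add: CBlinfun_inverse)
qed

lemma cinner_adjoint_left: "cinner (adjoint T *\<^sub>V y) x = cinner y (T *\<^sub>V x)"
proof -
  obtain S where S: "\<forall>x y. cinner (S *\<^sub>V y) x = cinner y (T *\<^sub>V x)"
    using adjoint_exists by blast
  have "adjoint T = S"
    unfolding adjoint_def
  proof (rule the_equality)
    fix S' assume "\<forall>x y. cinner (S' *\<^sub>V y) x = cinner y (T *\<^sub>V x)"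
    then show "S' = S" using S by (intro cblinfun_eqI cinner_eqI) simp
  qed (rule S)
  then show ?thesis using S by simp
qed

lemma cinner_adjoint_right: "cinner x (adjoint T *\<^sub>V y) = cinner (T *\<^sub>V x) y"
  by (subst (1 2) cinner_commute) (simp add: cinner_adjoint_left)

lemma adjoint_eqI: "(\<And>x y. cinner (S *\<^sub>V y) x = cinner y (T *\<^sub>V x)) \<Longrightarrow> adjoint T = S"
  by (intro cblinfun_eqI cinner_eqI) (simp add: cinner_adjoint_left)

lemma adjoint_adjoint: "adjoint (adjoint T) = T"
  by (rule adjoint_eqI) (simp add: cinner_adjoint_right)

lemma adjoint_compose: "adjoint (S o\<^sub>C T) = adjoint T o\<^sub>C adjoint S"
  by (rule adjoint_eqI) (simp add: cblinfun_simps cinner_adjoint_left)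

lemma cblinfun_compose_assoc: "(R o\<^sub>C S) o\<^sub>C T = R o\<^sub>C (S o\<^sub>C T)"
  by (rule cblinfun_eqI) (simp add: cblinfun_simps)

lemma cblinfun_compose_id [simp]: "T o\<^sub>C cblinfun_id = T" "cblinfun_id o\<^sub>C T = T"
  by (auto intro!: cblinfun_eqI simp: cblinfun_simps)

section \<open>Total sets\<close>

lemma bounded_clinear_compose:
  "bounded_clinear f \<Longrightarrow> bounded_clinear g \<Longrightarrow> bounded_clinear (\<lambda>x. f (g x))"
  by (simp add: bounded_clinear_iff bounded_linear_compose)

text \<open>This lets an identity between operators \<open>F a\<close> be checked for \<open>a\<close> in a total set
  of the algebra.\<close>

lemma bounded_clinear_apply_left:
  assumes "bounded_clinear F"
  shows "bounded_clinear (\<lambda>a. F a *\<^sub>V k)"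
  unfolding bounded_clinear_def clinear_iff
proof (intro conjI allI)
  fix a b c
  show "F (a + b) *\<^sub>V k = F a *\<^sub>V k + F b *\<^sub>V k" "F (c *\<^sub>C a) *\<^sub>V k = c *\<^sub>C (F a *\<^sub>V k)"
    using assms
    by (simp_all add: bounded_clinear_def clinear_iff plus_cblinfun.rep_eq scaleC_cblinfun.rep_eq)
  obtain K where K: "\<And>a. norm (F a) \<le> norm a * K"
    using assms by (auto simp: bounded_clinear_def)
  have "norm (F a *\<^sub>V k) \<le> norm a * (K * norm k)" for a
    using mult_right_mono[OF K[of a], of "norm k"] norm_cblinfun_apply_le[of "F a" k]
    by (simp add: mult.assoc)
  then show "\<exists>K. \<forall>a. norm (F a *\<^sub>V k) \<le> norm a * K" by blast
qed

lemma bounded_clinear_eq_on_total: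
  assumes f: "bounded_clinear f" and g: "bounded_clinear g"
    and total: "closed_cspan S = UNIV" and eq: "\<And>x. x \<in> S \<Longrightarrow> f x = g x"
  shows "f x = g x"
proof -
  let ?E = "{x. f x = g x}"
  have "complex_vector.subspace ?E"
    using f g
    by (auto simp: complex_vector.subspace_def bounded_clinear_iff linear_simps)
  then have "complex_vector.span S \<subseteq> ?E"
    using eq by (intro complex_vector.span_minimal) auto
  moreover have "closed ?E"
    using f g by (intro closed_Collect_eq) (auto simp: bounded_clinear_iff linear_continuous_on)
  ultimately have "closure (complex_vector.span S) \<subseteq> ?E" by (rule closure_minimal)
  then show ?thesis using total by (auto simp: closed_cspan_def)
qed

lemma cblinfun_eq_on_total:
  assumes "closed_cspan S = UNIV" and "\<And>x. x \<in> S \<Longrightarrow> A *\<^sub>V x = B *\<^sub>V x"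
  shows "A = B"
  using bounded_clinear_eq_on_total[OF bounded_clinear_cblinfun_apply bounded_clinear_cblinfun_apply
      assms] by (rule cblinfun_eqI)

section \<open>Unitary operators from Gram matrices\<close>

lemma unitaryI:
  assumes norm: "\<And>x. norm (U *\<^sub>V x) = norm x" and surj: "surj (cblinfun_apply U)"
  shows "unitary U"
proof -
  have Re: "Re (cinner (U *\<^sub>V x) (U *\<^sub>V y)) = Re (cinner x y)" for x y
    using norm_add_sq[of "U *\<^sub>V x" "U *\<^sub>V y"] norm_add_sq[of x y]
    by (simp add: norm flip: cblinfun_add)
  have "cinner (U *\<^sub>V x) (U *\<^sub>V y) = cinner x y" for x y
    using Re[of x y] Re[of x "\<i> *\<^sub>C y"]
    by (simp add: complex_eq_iff Im_cinner cblinfun_scaleC)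
  then have left: "adjoint U *\<^sub>V U *\<^sub>V x = x" for x
    by (intro cinner_eqI) (simp add: cinner_adjoint_left)
  have "U *\<^sub>V adjoint U *\<^sub>V y = y" for y
    using surj left by (metis surjD)
  with left show ?thesis
    by (auto simp: unitary_def cblinfun_simps intro!: cblinfun_eqI)
qed

text \<open>The graph of the assignment \<open>f i \<mapsto> g i\<close> extended linearly. It is kept as a relation because
  linear dependences among the \<open>f i\<close> leave open whether the extension is single-valued, until the
  inner products have been compared. Its symmetry in \<open>f\<close> and \<open>g\<close> gives surjectivity for
  free.\<close>

inductive matched :: "('i \<Rightarrow> 'k::complex_vector) \<Rightarrow> ('i \<Rightarrow> 'l::complex_vector) \<Rightarrow> 'k \<Rightarrow> 'l \<Rightarrow> bool"
  for f g where
  zero: "matched f g 0 0"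
| gen: "matched f g x y \<Longrightarrow> matched f g (c *\<^sub>C f i + x) (c *\<^sub>C g i + y)"

lemma matched_sym: "matched f g x y \<Longrightarrow> matched g f y x"
  by (induction rule: matched.induct) (auto intro: matched.intros)

lemma matched_add: "matched f g x y \<Longrightarrow> matched f g x' y' \<Longrightarrow> matched f g (x + x') (y + y')"
  by (induction rule: matched.induct) (auto intro: matched.intros simp: add.assoc)

lemma matched_scaleC: "matched f g x y \<Longrightarrow> matched f g (c *\<^sub>C x) (c *\<^sub>C y)"
proof (induction rule: matched.induct)
  case zero
  show ?case using matched.zero[of f g] by simp
next
  case (gen x y d i)
  then show ?case
    using matched.gen[OF gen.IH, of "c * d" i] by (simp add: scaleC_add_right scaleC_scaleC)
qed

lemma matched_generator: "matched f g (f i) (g i)"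
  using matched.gen[OF matched.zero, of f g 1 i] by simp

lemma matched_diff: "matched f g x y \<Longrightarrow> matched f g x' y' \<Longrightarrow> matched f g (x - x') (y - y')"
  using matched_add[OF _ matched_scaleC[of f g x' y' "-1"], of x y] by simp

lemma matched_total: "x \<in> complex_vector.span (range f) \<Longrightarrow> \<exists>y. matched f g x y"
proof (induction rule: complex_vector.span_induct_alt)
  case base
  show ?case by (blast intro: matched.zero)
next
  case (step c x y)
  then show ?case by (auto intro: matched.gen)
qed

text \<open>Inner products of linear combinations are sesquilinear expressions in the Gram matrix.\<close>

lemma matched_norm_eq:
  fixes f :: "'i \<Rightarrow> 'k::complex_inner" and g :: "'i \<Rightarrow> 'l::complex_inner"
  assumes gram: "\<And>i j. cinner (f i) (f j) = cinner (g i) (g j)"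
    and "matched f g x y"
  shows "norm x = norm y"
proof -
  have gen: "cinner (f i) x = cinner (g i) y" if "matched f g x y" for i x y
    using that
    by (induction rule: matched.induct) (simp_all add: cinner_add_right cinner_scaleC_right gram)
  have "cinner x x' = cinner y y'" if "matched f g x y" "matched f g x' y'" for x y x' y'
    using that
    by (induction rule: matched.induct) (simp_all add: cinner_add_left cinner_scaleC_left gen)
  then show ?thesis using assms(2) by (simp add: norm_eq_sqrt_cinner)
qed

definition matched_limit ::
  "('i \<Rightarrow> 'k::complex_normed_vector) \<Rightarrow> ('i \<Rightarrow> 'l::complex_normed_vector) \<Rightarrow> 'k \<Rightarrow> 'l \<Rightarrow> bool" where
  "matched_limit f g x y \<longleftrightarrow>
     (\<exists>X Y. (\<forall>n. matched f g (X n) (Y n)) \<and> X \<longlonglongrightarrow> x \<and> Y \<longlonglongrightarrow> y)"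

lemma matched_limit_sym: "matched_limit f g x y \<Longrightarrow> matched_limit g f y x"
  unfolding matched_limit_def by (blast intro: matched_sym)

lemma matched_limit_add:
  assumes "matched_limit f g x y" "matched_limit f g x' y'"
  shows "matched_limit f g (x + x') (y + y')"
proof -
  from assms obtain X Y X' Y' where
    "\<forall>n. matched f g (X n) (Y n)" "X \<longlonglongrightarrow> x" "Y \<longlonglongrightarrow> y"
    "\<forall>n. matched f g (X' n) (Y' n)" "X' \<longlonglongrightarrow> x'" "Y' \<longlonglongrightarrow> y'"
    unfolding matched_limit_def by blast
  then show ?thesis
    unfolding matched_limit_def
    by (intro exI[of _ "\<lambda>n. X n + X' n"] exI[of _ "\<lambda>n. Y n + Y' n"])
      (auto intro: matched_add tendsto_add)
qed

lemma bounded_clinear_scaleC: "bounded_clinear (\<lambda>x :: 'a::complex_normed_vector. c *\<^sub>C x)"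
  unfolding bounded_clinear_def clinear_iff
  by (auto simp: scaleC_add_right scaleC_scaleC mult.commute norm_scaleC intro!: exI[of _ "cmod c"])

lemma tendsto_scaleC:
  fixes x :: "'a::complex_normed_vector"
  shows "(X \<longlongrightarrow> x) F \<Longrightarrow> ((\<lambda>n. c *\<^sub>C X n) \<longlongrightarrow> c *\<^sub>C x) F"
  using bounded_clinear_scaleC[of c, where 'a = 'a] bounded_linear.tendsto
  by (auto simp: bounded_clinear_iff)

lemma matched_limit_scaleC:
  assumes "matched_limit f g x y"
  shows "matched_limit f g (c *\<^sub>C x) (c *\<^sub>C y)"
proof -
  from assms obtain X Y where XY: "\<forall>n. matched f g (X n) (Y n)" "X \<longlonglongrightarrow> x" "Y \<longlonglongrightarrow> y"
    unfolding matched_limit_def by blast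
  show ?thesis
    unfolding matched_limit_def
    by (intro exI[of _ "\<lambda>n. c *\<^sub>C X n"] exI[of _ "\<lambda>n. c *\<^sub>C Y n"])
      (use XY in \<open>auto intro: matched_scaleC tendsto_scaleC\<close>)
qed

lemma matched_limit_norm_eq:
  fixes f :: "'i \<Rightarrow> 'k::complex_inner" and g :: "'i \<Rightarrow> 'l::complex_inner"
  assumes gram: "\<And>i j. cinner (f i) (f j) = cinner (g i) (g j)"
    and "matched_limit f g x y"
  shows "norm x = norm y"
proof -
  from assms(2) obtain X Y where XY: "\<forall>n. matched f g (X n) (Y n)" "X \<longlonglongrightarrow> x" "Y \<longlonglongrightarrow> y"
    unfolding matched_limit_def by blast
  have "(\<lambda>n. norm (X n)) = (\<lambda>n. norm (Y n))" using matched_norm_eq[of f g, OF gram] XY(1) by (intro ext) blast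
  then show ?thesis using tendsto_norm[OF XY(2)] tendsto_norm[OF XY(3)] LIMSEQ_unique by metis
qed

text \<open>A sequence in the span of \<open>f\<close> converging to \<open>x\<close> is matched to a sequence with the same
  mutual distances, hence a Cauchy sequence.\<close>

lemma matched_limit_total:
  fixes f :: "'i \<Rightarrow> 'k::complex_inner" and g :: "'i \<Rightarrow> 'l::chilbert_space"
  assumes gram: "\<And>i j. cinner (f i) (f j) = cinner (g i) (g j)"
    and total: "closed_cspan (range f) = UNIV"
  shows "\<exists>y. matched_limit f g x y"
proof -
  obtain X where X: "\<And>n. X n \<in> complex_vector.span (range f)" "X \<longlonglongrightarrow> x"
    using total by (metis UNIV_I closed_cspan_def closure_sequential)
  obtain Y where XY: "\<And>n. matched f g (X n) (Y n)" using matched_total[OF X(1)] by metis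
  have "dist (Y m) (Y n) = dist (X m) (X n)" for m n
    using matched_norm_eq[OF gram matched_diff[OF XY XY]] by (simp add: dist_norm)
  then have "Cauchy Y" using LIMSEQ_imp_Cauchy[OF X(2)] by (simp add: Cauchy_def)
  then obtain y where "Y \<longlonglongrightarrow> y" using Cauchy_convergent convergentD by blast
  then show ?thesis using X(2) XY unfolding matched_limit_def by blast
qed

text \<open>The closure of the graph is the graph of an everywhere defined isometry: it is single-valued
  because it preserves norms, and total in both directions because both families are total.\<close>

lemma unitary_of_equal_gram:
  fixes f :: "'i \<Rightarrow> 'k::chilbert_space" and g :: "'i \<Rightarrow> 'l::chilbert_space"
  assumes gram: "\<And>i j. cinner (f i) (f j) = cinner (g i) (g j)"
    and f: "closed_cspan (range f) = UNIV" and g: "closed_cspan (range g) = UNIV"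
  shows "\<exists>U. unitary U \<and> (\<forall>i. U *\<^sub>V f i = g i)"
proof -
  have unique: "y = y'" if "matched_limit f g x y" "matched_limit f g x y'" for x y y'
    using matched_limit_norm_eq[OF gram
        matched_limit_add[OF that(1) matched_limit_scaleC[OF that(2), of "-1"]]]
    by simp
  obtain h where h: "\<And>x. matched_limit f g x (h x)"
    using matched_limit_total[OF gram f] by metis
  have norm: "norm (h x) = norm x" for x using matched_limit_norm_eq[OF gram h] by simp
  have "bounded_clinear h"
    unfolding bounded_clinear_def clinear_iff
    using unique[OF h matched_limit_add[OF h h]] unique[OF h matched_limit_scaleC[OF h]] norm
    by (auto intro!: exI[of _ 1])
  then have CBlinfun_h: "CBlinfun h *\<^sub>V x = h x" for x by (simp add: CBlinfun_inverse)
  have "\<exists>x. h x = y" for y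
  proof -
    obtain x where "matched_limit g f y x"
      using matched_limit_total[OF gram[symmetric] g] by blast
    then show ?thesis using unique[OF h matched_limit_sym] by blast
  qed
  then have "unitary (CBlinfun h)" by (intro unitaryI) (auto simp: CBlinfun_h norm surj_def, metis)
  moreover have "matched_limit f g (f i) (g i)" for i
    unfolding matched_limit_def using matched_generator[of f g i]
    by (intro exI[of _ "\<lambda>_. f i"] exI[of _ "\<lambda>_. g i"]) simp
  ultimately show ?thesis using unique[OF h] CBlinfun_h by metis
qed


section \<open>Covariant KSGNS constructions\<close>

lemma krein_symmetry: "krein_space J \<Longrightarrow> J *\<^sub>V J *\<^sub>V x = x"
  by (metis krein_space_def cblinfun_simps)

text \<open>Commutation with the symmetries is the form of this condition that can be checked on a
  total set.\<close>

lemma kadj_eq_adjoint_iff: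
  assumes J: "krein_space J" and J': "krein_space J'"
  shows "kadj J J' T = adjoint T \<longleftrightarrow> T o\<^sub>C J = J' o\<^sub>C T"
proof
  assume T: "kadj J J' T = adjoint T"
  have "T = adjoint (kadj J J' T)" by (simp add: T adjoint_adjoint)
  also have "\<dots> = J' o\<^sub>C T o\<^sub>C J"
    using J J' by (simp add: kadj_def adjoint_compose adjoint_adjoint krein_space_def cblinfun_compose_assoc)
  finally show "T o\<^sub>C J = J' o\<^sub>C T"
    using J by (metis cblinfun_compose_assoc cblinfun_compose_id(1) krein_space_def)
next
  assume "T o\<^sub>C J = J' o\<^sub>C T"
  then have "J o\<^sub>C adjoint T = adjoint T o\<^sub>C J'"
    using J J' by (metis adjoint_compose krein_space_def)
  then show "kadj J J' T = adjoint T"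
    using J' by (metis kadj_def cblinfun_compose_assoc cblinfun_compose_id(1) krein_space_def)
qed

lemma unitary_cancel_right: "unitary U \<Longrightarrow> T o\<^sub>C U o\<^sub>C adjoint U = T"
  by (simp add: unitary_def cblinfun_compose_assoc)

text \<open>One minimal construction over a full module, so that the formulas below can be instantiated
  at each of the two constructions to be compared.\<close>

locale minimal_covariant_KSGNS = full_hilbert_module act ip
  for act :: "'x::{complex_normed_vector, banach} \<Rightarrow> 'a::unital_cstar_algebra \<Rightarrow> 'x"
    and ip :: "'x \<Rightarrow> 'x \<Rightarrow> 'a" +
  fixes \<alpha> :: "'a \<Rightarrow> 'a"
    and \<eta> :: "'g::group_add \<Rightarrow> 'x \<Rightarrow> 'x"
    and J1 :: "'h1::chilbert_space \<Rightarrow>\<^sub>C\<^sub>L 'h1"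
    and u :: "'g \<Rightarrow> 'h1 \<Rightarrow>\<^sub>C\<^sub>L 'h1"
    and u' :: "'g \<Rightarrow> 'h2::chilbert_space \<Rightarrow>\<^sub>C\<^sub>L 'h2"
    and \<phi> :: "'a \<Rightarrow> 'h1 \<Rightarrow>\<^sub>C\<^sub>L 'h1"
    and \<Phi> :: "'x \<Rightarrow> 'h1 \<Rightarrow>\<^sub>C\<^sub>L 'h2"
    and \<pi>X :: "'x \<Rightarrow> 'k1::chilbert_space \<Rightarrow>\<^sub>C\<^sub>L 'k2::chilbert_space"
    and \<pi>A :: "'a \<Rightarrow> 'k1 \<Rightarrow>\<^sub>C\<^sub>L 'k1"
    and V :: "'h1 \<Rightarrow>\<^sub>C\<^sub>L 'k1"
    and W :: "'h2 \<Rightarrow>\<^sub>C\<^sub>L 'k2"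
    and v :: "'g \<Rightarrow> 'k1 \<Rightarrow>\<^sub>C\<^sub>L 'k1"
    and v' :: "'g \<Rightarrow> 'k2 \<Rightarrow>\<^sub>C\<^sub>L 'k2"
    and J3 :: "'k1 \<Rightarrow>\<^sub>C\<^sub>L 'k1"
    and J4 :: "'k2 \<Rightarrow>\<^sub>C\<^sub>L 'k2"
  assumes J1: "krein_space J1"
    and construction:
      "covariant_KSGNS \<alpha> ip \<eta> J1 cblinfun_id u u' \<phi> \<Phi> \<pi>X \<pi>A V W v v' J3 J4"
    and minimal: "minimal_KSGNS \<pi>X \<pi>A V"
begin

lemma J3: "krein_space J3" and J4: "krein_space J4"
  using construction by (simp_all add: covariant_KSGNS_def)

lemma bounded_clinear_\<pi>A: "bounded_clinear \<pi>A"
  using construction by (simp add: covariant_KSGNS_def krein_representation_def)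

lemma \<pi>A_mult: "\<pi>A (a * b) *\<^sub>V k = \<pi>A a *\<^sub>V \<pi>A b *\<^sub>V k"
  using construction by (simp add: covariant_KSGNS_def krein_representation_def cblinfun_simps)

lemma adjoint_\<pi>A_J3: "adjoint (\<pi>A a) *\<^sub>V J3 *\<^sub>V k = J3 *\<^sub>V \<pi>A (star a) *\<^sub>V k"
  using construction
  by (simp add: covariant_KSGNS_def krein_representation_def kadj_def cblinfun_simps krein_symmetry)

lemma total_\<pi>A: "closed_cspan (range (\<lambda>(a, h). \<pi>A a *\<^sub>V V *\<^sub>V h)) = UNIV"
proof -
  have "range (\<lambda>(a, h). \<pi>A a *\<^sub>V V *\<^sub>V h) = {\<pi>A a *\<^sub>V V *\<^sub>V h | a h. True}" by auto
  then show ?thesis using minimal by (simp add: minimal_KSGNS_def)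
qed

lemma total_\<pi>X: "closed_cspan (range (\<lambda>(x, h). \<pi>X x *\<^sub>V V *\<^sub>V h)) = UNIV"
proof -
  have "range (\<lambda>(x, h). \<pi>X x *\<^sub>V V *\<^sub>V h) = {\<pi>X x *\<^sub>V V *\<^sub>V h | x h. True}" by auto
  then show ?thesis using minimal by (simp add: minimal_KSGNS_def)
qed

lemma eq_on_\<pi>A: "(\<And>a h. S *\<^sub>V \<pi>A a *\<^sub>V V *\<^sub>V h = T *\<^sub>V \<pi>A a *\<^sub>V V *\<^sub>V h) \<Longrightarrow> S = T"
  by (rule cblinfun_eq_on_total[OF total_\<pi>A]) auto

lemma eq_on_\<pi>X: "(\<And>x h. S *\<^sub>V \<pi>X x *\<^sub>V V *\<^sub>V h = T *\<^sub>V \<pi>X x *\<^sub>V V *\<^sub>V h) \<Longrightarrow> S = T"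
  by (rule cblinfun_eq_on_total[OF total_\<pi>X]) auto

text \<open>As the symmetry of the second original space is trivial, the adjoint of \<open>W\<close> absorbs
  \<open>J4\<close>; a coisometry has a left-cancellable adjoint.\<close>

lemma J4_eq_id: "J4 = cblinfun_id"
proof -
  have "W o\<^sub>C (adjoint W o\<^sub>C J4) = W o\<^sub>C adjoint W"
    using construction by (simp add: covariant_KSGNS_def kadj_def)
  then show ?thesis
    using construction
    by (simp add: covariant_KSGNS_def coisometry_def flip: cblinfun_compose_assoc)
qed

text \<open>Multiplicativity alone makes \<open>\<pi>A 1\<close> an idempotent; it fixes the total family, so
  minimality makes it the identity.\<close>

lemma \<pi>A_one: "\<pi>A 1 *\<^sub>V k = k"
proof -
  have "\<pi>A 1 = cblinfun_id"
    by (rule eq_on_\<pi>A) (simp add: cblinfun_simps flip: \<pi>A_mult)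
  then show ?thesis by (simp add: cblinfun_simps)
qed

lemma J3_\<pi>A_V: "J3 *\<^sub>V \<pi>A a *\<^sub>V V *\<^sub>V h = \<pi>A (\<alpha> a) *\<^sub>V V *\<^sub>V J1 *\<^sub>V h"
proof -
  have "\<pi>A (\<alpha> a) o\<^sub>C V = J3 o\<^sub>C \<pi>A a o\<^sub>C V o\<^sub>C J1"
    using construction by (simp add: covariant_KSGNS_def)
  then have "\<pi>A (\<alpha> a) *\<^sub>V V *\<^sub>V J1 *\<^sub>V h = J3 *\<^sub>V \<pi>A a *\<^sub>V V *\<^sub>V J1 *\<^sub>V J1 *\<^sub>V h"
    by (metis cblinfun_compose.rep_eq)
  then show ?thesis by (simp add: krein_symmetry[OF J1])
qed

lemma \<phi>_eq: "adjoint V *\<^sub>V \<pi>A a *\<^sub>V V *\<^sub>V h = \<phi> a *\<^sub>V h"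
  using construction by (simp add: covariant_KSGNS_def cblinfun_simps)

lemma adjoint_W_\<pi>X_V: "adjoint W *\<^sub>V \<pi>X x *\<^sub>V V *\<^sub>V h = \<Phi> x *\<^sub>V h"
  using construction by (simp add: covariant_KSGNS_def cblinfun_simps)

lemma adjoint_V_J3: "adjoint V *\<^sub>V J3 *\<^sub>V k = J1 *\<^sub>V adjoint V *\<^sub>V k"
proof -
  have "adjoint V = J1 o\<^sub>C adjoint V o\<^sub>C J3"
    using construction by (simp add: covariant_KSGNS_def kadj_def)
  then have "adjoint V *\<^sub>V J3 *\<^sub>V k = J1 *\<^sub>V adjoint V *\<^sub>V J3 *\<^sub>V J3 *\<^sub>V k"
    by (metis cblinfun_compose.rep_eq)
  then show ?thesis by (simp add: krein_symmetry[OF J3])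
qed

text \<open>Insert \<open>J3\<close> twice between the two factors: one copy passes \<open>\<pi>A b\<close> and becomes \<open>\<alpha>\<close>,
  the other turns the adjoint of \<open>\<pi>A a\<close> into \<open>\<pi>A (star a)\<close> and leaves through the adjoint
  of \<open>V\<close>.\<close>

lemma gram_\<pi>A:
  "cinner (\<pi>A a *\<^sub>V V *\<^sub>V h) (\<pi>A b *\<^sub>V V *\<^sub>V k) = cinner h (J1 *\<^sub>V \<phi> (star a * \<alpha> b) *\<^sub>V J1 *\<^sub>V k)"
proof -
  have "adjoint (\<pi>A a) *\<^sub>V \<pi>A b *\<^sub>V V *\<^sub>V k
      = adjoint (\<pi>A a) *\<^sub>V J3 *\<^sub>V \<pi>A (\<alpha> b) *\<^sub>V V *\<^sub>V J1 *\<^sub>V k"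
    by (metis J3_\<pi>A_V krein_symmetry[OF J3])
  also have "\<dots> = J3 *\<^sub>V \<pi>A (star a * \<alpha> b) *\<^sub>V V *\<^sub>V J1 *\<^sub>V k"
    by (simp only: adjoint_\<pi>A_J3 \<pi>A_mult)
  finally have "adjoint V *\<^sub>V adjoint (\<pi>A a) *\<^sub>V \<pi>A b *\<^sub>V V *\<^sub>V k
      = J1 *\<^sub>V \<phi> (star a * \<alpha> b) *\<^sub>V J1 *\<^sub>V k"
    by (simp add: adjoint_V_J3 \<phi>_eq)
  then show ?thesis by (simp flip: cinner_adjoint_right)
qed

lemma gram_\<pi>X:
  "cinner (\<pi>X x *\<^sub>V V *\<^sub>V h) (\<pi>X y *\<^sub>V V *\<^sub>V k) = cinner (\<Phi> x *\<^sub>V h) (\<Phi> y *\<^sub>V k)"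
proof -
  have "W *\<^sub>V adjoint W *\<^sub>V k = k" for k
    using construction by (metis covariant_KSGNS_def coisometry_def cblinfun_simps)
  then show ?thesis by (simp add: cinner_adjoint_left flip: adjoint_W_\<pi>X_V)
qed

lemma adjoint_\<pi>X_\<pi>X: "adjoint (\<pi>X x) *\<^sub>V \<pi>X y *\<^sub>V k = J3 *\<^sub>V \<pi>A (ip x y) *\<^sub>V k"
proof -
  have "\<pi>A (ip x y) = J3 o\<^sub>C adjoint (\<pi>X x) o\<^sub>C \<pi>X y"
    using construction
    by (simp add: covariant_KSGNS_def module_representation_def kadj_def J4_eq_id)
  then have "J3 *\<^sub>V adjoint (\<pi>X x) *\<^sub>V \<pi>X y *\<^sub>V k = \<pi>A (ip x y) *\<^sub>V k"
    by (simp add: cblinfun_simps)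
  then show ?thesis by (metis krein_symmetry[OF J3])
qed

text \<open>A module representation is not assumed to respect the right action. The adjoints of the two
  sides agree on the total family \<open>\<pi>X z (V h)\<close>, since there they only involve \<open>\<pi>A\<close> of inner
  products.\<close>

lemma \<pi>X_act: "\<pi>X (act x a) *\<^sub>V k = \<pi>X x *\<^sub>V \<pi>A a *\<^sub>V k"
proof -
  have ip: "ip (act x a) z = star a * ip x z" for z
    by (metis ip_act_right ip_star star_mult)
  have "adjoint (\<pi>X (act x a)) = adjoint (\<pi>X x o\<^sub>C \<pi>A a)"
    by (rule eq_on_\<pi>X)
      (simp add: adjoint_compose cblinfun_simps adjoint_\<pi>X_\<pi>X ip \<pi>A_mult adjoint_\<pi>A_J3)
  then show ?thesis by (metis adjoint_adjoint cblinfun_compose.rep_eq)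
qed

lemma v_adjoint:
  "adjoint (v t) *\<^sub>V v t *\<^sub>V k = k" "v t *\<^sub>V J3 *\<^sub>V k = J3 *\<^sub>V v t *\<^sub>V k"
proof -
  have adj: "v (- t) = adjoint (v t)" and v: "v 0 = cblinfun_id" "v (- t + t) = v (- t) o\<^sub>C v t"
    and kadj: "kadj J3 J3 (v t) = adjoint (v t)"
    using construction by (simp_all add: covariant_KSGNS_def pseudo_unitary_rep_def del: add.left_inverse)
  then have "adjoint (v t) o\<^sub>C v t = cblinfun_id" by simp
  then show "adjoint (v t) *\<^sub>V v t *\<^sub>V k = k"
    by (metis cblinfun_simps)
  show "v t *\<^sub>V J3 *\<^sub>V k = J3 *\<^sub>V v t *\<^sub>V k"
    using kadj kadj_eq_adjoint_iff[OF J3 J3] by (metis cblinfun_simps(1))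
qed

lemma v'_adjoint: "adjoint (v' t) *\<^sub>V v' t *\<^sub>V k = k"
proof -
  have "v' (- t) = adjoint (v' t)" "v' 0 = cblinfun_id" "v' (- t + t) = v' (- t) o\<^sub>C v' t"
    using construction by (simp_all add: covariant_KSGNS_def pseudo_unitary_rep_def del: add.left_inverse)
  then have "adjoint (v' t) o\<^sub>C v' t = cblinfun_id" by simp
  then show ?thesis by (metis cblinfun_simps)
qed

lemma \<pi>X_\<eta>: "\<pi>X (\<eta> t x) = v' t o\<^sub>C \<pi>X x o\<^sub>C adjoint (v t)"
  using construction by (simp add: covariant_KSGNS_def covariant_def)

lemma V_u: "V *\<^sub>V u t *\<^sub>V h = v t *\<^sub>V V *\<^sub>V h"
  using construction by (metis covariant_KSGNS_def cblinfun_compose.rep_eq)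

lemma v'_\<pi>X_V: "v' t *\<^sub>V \<pi>X x *\<^sub>V V *\<^sub>V h = \<pi>X (\<eta> t x) *\<^sub>V V *\<^sub>V u t *\<^sub>V h"
  by (simp add: \<pi>X_\<eta> V_u cblinfun_simps v_adjoint)

text \<open>Writing \<open>\<pi>A (ip x y)\<close> through \<open>\<pi>X x\<close> and \<open>\<pi>X y\<close> turns the covariance of \<open>\<pi>X\<close> into one
  of \<open>\<pi>A\<close>, expressed directly by \<open>\<eta> t\<close> instead of the automorphism that it induces on the
  algebra.\<close>

lemma v_\<pi>A_ip_V:
  "v t *\<^sub>V \<pi>A (ip x y) *\<^sub>V V *\<^sub>V h = \<pi>A (ip (\<eta> t x) (\<eta> t y)) *\<^sub>V V *\<^sub>V u t *\<^sub>V h"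
proof -
  have "J3 *\<^sub>V \<pi>A (ip (\<eta> t x) (\<eta> t y)) *\<^sub>V V *\<^sub>V u t *\<^sub>V h
      = adjoint (\<pi>X (\<eta> t x)) *\<^sub>V v' t *\<^sub>V \<pi>X y *\<^sub>V V *\<^sub>V h"
    by (simp add: v'_\<pi>X_V adjoint_\<pi>X_\<pi>X)
  also have "\<dots> = v t *\<^sub>V J3 *\<^sub>V \<pi>A (ip x y) *\<^sub>V V *\<^sub>V h"
    by (simp add: \<pi>X_\<eta> adjoint_compose adjoint_adjoint cblinfun_simps v'_adjoint adjoint_\<pi>X_\<pi>X)
  finally show ?thesis by (metis v_adjoint(2) krein_symmetry[OF J3])
qed

end

section \<open>Uniqueness\<close>

theorem proposition3p5:
  fixes \<alpha> :: "'a::unital_cstar_algebra \<Rightarrow> 'a"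
    and act :: "'x::{complex_normed_vector, banach} \<Rightarrow> 'a \<Rightarrow> 'x"
    and ip :: "'x \<Rightarrow> 'x \<Rightarrow> 'a"
    and \<eta> :: "'g::{topological_group_add, t2_space} \<Rightarrow> 'x \<Rightarrow> 'x"
    and J1 :: "'h1::chilbert_space \<Rightarrow>\<^sub>C\<^sub>L 'h1"
    and J2 :: "'h2::chilbert_space \<Rightarrow>\<^sub>C\<^sub>L 'h2"
    and u :: "'g \<Rightarrow> 'h1 \<Rightarrow>\<^sub>C\<^sub>L 'h1"
    and u' :: "'g \<Rightarrow> 'h2 \<Rightarrow>\<^sub>C\<^sub>L 'h2"
    and \<phi> :: "'a \<Rightarrow> 'h1 \<Rightarrow>\<^sub>C\<^sub>L 'h1"
    and \<Phi> :: "'x \<Rightarrow> 'h1 \<Rightarrow>\<^sub>C\<^sub>L 'h2"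
    and \<pi>X :: "'x \<Rightarrow> 'k1::chilbert_space \<Rightarrow>\<^sub>C\<^sub>L 'k2::chilbert_space"
    and \<pi>A :: "'a \<Rightarrow> 'k1 \<Rightarrow>\<^sub>C\<^sub>L 'k1"
    and V :: "'h1 \<Rightarrow>\<^sub>C\<^sub>L 'k1"
    and W :: "'h2 \<Rightarrow>\<^sub>C\<^sub>L 'k2"
    and v :: "'g \<Rightarrow> 'k1 \<Rightarrow>\<^sub>C\<^sub>L 'k1"
    and v' :: "'g \<Rightarrow> 'k2 \<Rightarrow>\<^sub>C\<^sub>L 'k2"
    and J3 :: "'k1 \<Rightarrow>\<^sub>C\<^sub>L 'k1"
    and J4 :: "'k2 \<Rightarrow>\<^sub>C\<^sub>L 'k2"
    and \<pi>X' :: "'x \<Rightarrow> 'l1::chilbert_space \<Rightarrow>\<^sub>C\<^sub>L 'l2::chilbert_space"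
    and \<pi>A' :: "'a \<Rightarrow> 'l1 \<Rightarrow>\<^sub>C\<^sub>L 'l1"
    and V' :: "'h1 \<Rightarrow>\<^sub>C\<^sub>L 'l1"
    and W' :: "'h2 \<Rightarrow>\<^sub>C\<^sub>L 'l2"
    and w :: "'g \<Rightarrow> 'l1 \<Rightarrow>\<^sub>C\<^sub>L 'l1"
    and w' :: "'g \<Rightarrow> 'l2 \<Rightarrow>\<^sub>C\<^sub>L 'l2"
    and J3' :: "'l1 \<Rightarrow>\<^sub>C\<^sub>L 'l1"
    and J4' :: "'l2 \<Rightarrow>\<^sub>C\<^sub>L 'l2"
  assumes "krein_cstar_algebra \<alpha>"
    and "full_hilbert_module act ip"
    and "locally_compact_space (euclidean :: 'g topology)"
    and "module_action ip \<eta>"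
    and "krein_space J1"
    and "krein_space J2" and "J2 = cblinfun_id"
    and "unitary_pseudo_unitary_rep J1 u"
    and "pseudo_unitary_rep J2 u'"
    and "alpha_CP \<alpha> J1 \<phi>"
    and "covariant_phi_map \<alpha> ip \<eta> J1 J2 u' u \<phi> \<Phi>"
    and "covariant_KSGNS \<alpha> ip \<eta> J1 J2 u u' \<phi> \<Phi> \<pi>X \<pi>A V W v v' J3 J4"
    and "minimal_KSGNS \<pi>X \<pi>A V"
    and "covariant_KSGNS \<alpha> ip \<eta> J1 J2 u u' \<phi> \<Phi> \<pi>X' \<pi>A' V' W' w w' J3' J4'"
    and "minimal_KSGNS \<pi>X' \<pi>A' V'"
  shows "\<exists>(U1 :: 'k1 \<Rightarrow>\<^sub>C\<^sub>L 'l1) (U2 :: 'k2 \<Rightarrow>\<^sub>C\<^sub>L 'l2). unitary U1 \<and> unitary U2 \<and>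
    (U1 o\<^sub>C V = V' \<and>
     (\<forall>a. U1 o\<^sub>C \<pi>A a o\<^sub>C kadj J3 J3' U1 = \<pi>A' a) \<and>
     (\<forall>t. U1 o\<^sub>C v t o\<^sub>C kadj J3 J3' U1 = w t)) \<and>
    (U2 o\<^sub>C W = W' \<and>
     (\<forall>x. U2 o\<^sub>C \<pi>X x o\<^sub>C kadj J3 J3' U1 = \<pi>X' x) \<and>
     (\<forall>t. U2 o\<^sub>C v' t o\<^sub>C kadj J4 J4' U2 = w' t))"
proof -
  interpret K: minimal_covariant_KSGNS act ip \<alpha> \<eta> J1 u u' \<phi> \<Phi> \<pi>X \<pi>A V W v v' J3 J4
    using assms by (simp add: minimal_covariant_KSGNS_def minimal_covariant_KSGNS_axioms_def)
  interpret L: minimal_covariant_KSGNS act ip \<alpha> \<eta> J1 u u' \<phi> \<Phi> \<pi>X' \<pi>A' V' W' w w' J3' J4'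
    using assms by (simp add: minimal_covariant_KSGNS_def minimal_covariant_KSGNS_axioms_def)
  have "\<exists>U1. unitary U1 \<and> (\<forall>p. U1 *\<^sub>V (\<lambda>(a, h). \<pi>A a *\<^sub>V V *\<^sub>V h) p = (\<lambda>(a, h). \<pi>A' a *\<^sub>V V' *\<^sub>V h) p)"
    by (intro unitary_of_equal_gram K.total_\<pi>A L.total_\<pi>A) (auto simp: K.gram_\<pi>A L.gram_\<pi>A)
  then obtain U1 where unitary1: "unitary U1"
    and U1: "\<And>a h. U1 *\<^sub>V \<pi>A a *\<^sub>V V *\<^sub>V h = \<pi>A' a *\<^sub>V V' *\<^sub>V h"
    by auto
  have "\<exists>U2. unitary U2 \<and> (\<forall>p. U2 *\<^sub>V (\<lambda>(x, h). \<pi>X x *\<^sub>V V *\<^sub>V h) p = (\<lambda>(x, h). \<pi>X' x *\<^sub>V V' *\<^sub>V h) p)"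
    by (intro unitary_of_equal_gram K.total_\<pi>X L.total_\<pi>X) (auto simp: K.gram_\<pi>X L.gram_\<pi>X)
  then obtain U2 where unitary2: "unitary U2"
    and U2: "\<And>x h. U2 *\<^sub>V \<pi>X x *\<^sub>V V *\<^sub>V h = \<pi>X' x *\<^sub>V V' *\<^sub>V h"
    by auto
  have "U1 o\<^sub>C J3 = J3' o\<^sub>C U1"
    by (rule K.eq_on_\<pi>A) (simp add: cblinfun_simps K.J3_\<pi>A_V L.J3_\<pi>A_V U1)
  then have kadj1: "kadj J3 J3' U1 = adjoint U1"
    using kadj_eq_adjoint_iff[OF K.J3 L.J3] by blast
  have kadj2: "kadj J4 J4' U2 = adjoint U2"
    by (simp add: kadj_def K.J4_eq_id L.J4_eq_id)
  have "U1 o\<^sub>C V = V'"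
    using U1[of 1] by (intro cblinfun_eqI) (simp add: cblinfun_simps K.\<pi>A_one L.\<pi>A_one)
  moreover have "U1 o\<^sub>C \<pi>A a = \<pi>A' a o\<^sub>C U1" for a
    by (rule K.eq_on_\<pi>A) (simp add: cblinfun_simps U1 flip: K.\<pi>A_mult L.\<pi>A_mult)
  moreover have "U1 o\<^sub>C v t = w t o\<^sub>C U1" for t
  proof (rule K.eq_on_\<pi>A)
    fix a h
    have "U1 *\<^sub>V v t *\<^sub>V \<pi>A a *\<^sub>V V *\<^sub>V h = w t *\<^sub>V \<pi>A' a *\<^sub>V V' *\<^sub>V h"
      \<comment> \<open>both sides are bounded and linear in \<open>a\<close>, and the module is full\<close>
    proof (rule bounded_clinear_eq_on_total[OF _ _ K.full, of _ _ a])
      show "bounded_clinear (\<lambda>a. U1 *\<^sub>V v t *\<^sub>V \<pi>A a *\<^sub>V V *\<^sub>V h)"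
        "bounded_clinear (\<lambda>a. w t *\<^sub>V \<pi>A' a *\<^sub>V V' *\<^sub>V h)"
        by (intro bounded_clinear_compose[OF bounded_clinear_cblinfun_apply]
            bounded_clinear_apply_left K.bounded_clinear_\<pi>A L.bounded_clinear_\<pi>A)+
      fix b assume "b \<in> {ip x y | x y. True}"
      then show "U1 *\<^sub>V v t *\<^sub>V \<pi>A b *\<^sub>V V *\<^sub>V h = w t *\<^sub>V \<pi>A' b *\<^sub>V V' *\<^sub>V h"
        by (auto simp: K.v_\<pi>A_ip_V L.v_\<pi>A_ip_V U1)
    qed
    then show "(U1 o\<^sub>C v t) *\<^sub>V \<pi>A a *\<^sub>V V *\<^sub>V h = (w t o\<^sub>C U1) *\<^sub>V \<pi>A a *\<^sub>V V *\<^sub>V h"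
      by (simp add: cblinfun_simps U1)
  qed
  moreover have "U2 o\<^sub>C W = W'"
  proof -
    \<comment> \<open>\<open>W\<close> itself is not given by a formula on a total family of its domain, but its adjoint is\<close>
    have "adjoint W = adjoint W' o\<^sub>C U2"
      by (rule K.eq_on_\<pi>X) (simp add: cblinfun_simps U2 K.adjoint_W_\<pi>X_V L.adjoint_W_\<pi>X_V)
    then have "W = adjoint U2 o\<^sub>C W'" by (metis adjoint_adjoint adjoint_compose)
    then show ?thesis
      using unitary2 by (simp add: unitary_def flip: cblinfun_compose_assoc)
  qed
  moreover have "U2 o\<^sub>C \<pi>X x = \<pi>X' x o\<^sub>C U1" for x
    by (rule K.eq_on_\<pi>A) (simp add: cblinfun_simps U1 U2 flip: K.\<pi>X_act L.\<pi>X_act)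
  moreover have "U2 o\<^sub>C v' t = w' t o\<^sub>C U2" for t
    by (rule K.eq_on_\<pi>X) (simp add: cblinfun_simps U2 K.v'_\<pi>X_V L.v'_\<pi>X_V)
  ultimately show ?thesis
    using unitary1 unitary2
    by (intro exI[of _ U1] exI[of _ U2]) (simp add: kadj1 kadj2 unitary_cancel_right)
qed

end
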